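(* Let $n\ge2$ and let $\Phi\subset\mathbb{R}^{n+1}$ be a hypersurface of positive Gaussian curvature. If there is a relative normalization $\bar y$ of $\Phi$ whose Pick-invariant vanishes identically, then $\Phi$ is a hyperquadric. Furthermore, $\bar y$ is constantly proportional to the equiaffine normalization $\bar y_{\mathrm{aff}}$ of $\Phi$.
   Context: Let $n\ge2$. A hypersurface $\Phi=(M,\bar x)$ in $\mathbb{R}^{n+1}$ consists of an oriented connected $n$-dimensional $C^r$-manifold $M$ ($r\ge 3$) and a $C^r$-immersion $\bar x:M\to\mathbb{R}^{n+1}$ whose Gaussian curvature $K_I$ never vanishes. Let $u^1,\dots,u^n$ be local coordinates and write $f_{/i}=\partial f/\partial u^i$, etc. Let $\bar\xi$ be the Euclidean unit normal field, $h_{ij}=\langle\bar\xi,\bar x_{/ij}\rangle$ the components of the second fundamental form $II$, and $K_I=\det(h_{ij})/\det(\langle \bar x_{/i},\bar x_{/j}\rangle)$. A $C^s$-map $\bar y:M\to\mathbb{R}^{n+1}$ ($r>s\ge1$) is a relative normalization of $\Phi$ if at every point of $M$ the vectors $\bar x_{/1},\dots,\bar x_{/n},\bar y$ are linearly independent and every $\bar y_{/i}$ lies in the span of $\bar x_{/1},\dots,\bar x_{/n}$. The support function of $\bar y$ is $q=\langle\bar\xi,\bar y\rangle$; it never vanishes, and orientations are chosen so that $q>0$. The covector $\bar X$ is defined by $\langle\bar X,\bar x_{/i}\rangle=0$ for all $i$ and $\langle\bar X,\bar y\rangle=1$, so $\bar X=q^{-1}\bar\xi$. The relative metric is $G_{ij}=\langle\bar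 X,\bar x_{/ij}\rangle=q^{-1}h_{ij}$ (Riemannian or pseudo-Riemannian); indices are raised and lowered with $G$, and $\nabla^G$ is its covariant derivative. The Darboux tensor is $A_{jkl}=\langle\bar X,\nabla^G_l\nabla^G_k\bar x_{/j}\rangle$, and the Pick-invariant of $\bar y$ is $J=\frac1{n(n-1)}A_{jkl}A^{jkl}$. The equiaffine normalization $\bar y_{\mathrm{aff}}$ is the relative normalization with support function $q_{\mathrm{aff}}=|K_I|^{1/(n+2)}$. The normalizations $\bar y$ and $\bar y_{\mathrm{aff}}$ are called constantly proportional if $q=c\,q_{\mathrm{aff}}$ for a constant $c\in\mathbb{R}\setminus\{0\}$ (equivalently $\bar y=c\,\bar y_{\mathrm{aff}}$). "$\Phi$ is a hyperquadric" means that $\bar x(M)$ is contained in a hyperquadric of $\mathbb{R}^{n+1}$.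
   Formalization: For n ≥ 3 the second fundamental form is also assumed definite: positive Gaussian curvature alone does not suffice, e.g. the graph of x1x2+x3x4+x1^3 with constant vertical normalization has K>0 and zero Pick-invariant but lies in no hyperquadric. *)

theory Defs
  imports "HOL-Analysis.Analysis"
begin

section \<open>Functions of class \<open>C\<^sup>k\<close> on open subsets of Euclidean space\<close>

definition pd :: "'n::finite \<Rightarrow> (real^'n \<Rightarrow> 'b::real_normed_vector) \<Rightarrow> real^'n \<Rightarrow> 'b" where
  "pd i f u = frechet_derivative f (at u) (axis i 1)"

text \<open>Only meant for open \<open>S\<close>.\<close>

fun Ck_on :: "nat \<Rightarrow> (real^'n::finite \<Rightarrow> 'b::real_normed_vector) \<Rightarrow> (real^'n) set \<Rightarrow> bool" where
  "Ck_on 0 f S \<longleftrightarrow> continuous_on S f"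
| "Ck_on (Suc k) f S \<longleftrightarrow> (\<forall>u\<in>S. f differentiable (at u)) \<and> (\<forall>i. Ck_on k (pd i f) S)"

section \<open>Oriented manifolds of class \<open>C\<^sup>r\<close>\<close>

text \<open>
  The manifold is the carrier of a topology; its dimension is the cardinality of the index
  type \<open>'n\<close>.  A chart is a pair of a domain and a map that is relevant only on this domain.
\<close>

type_synonym ('a, 'n) chart = "'a set \<times> ('a \<Rightarrow> real^'n)"

definition coord_dom :: "('a, 'n::finite) chart \<Rightarrow> (real^'n) set" where
  "coord_dom c = snd c ` fst c"

definition in_coords :: "('a, 'n::finite) chart \<Rightarrow> ('a \<Rightarrow> 'b) \<Rightarrow> real^'n \<Rightarrow> 'b" where
  "in_coords c f = f \<circ> inv_into (fst c) (snd c)"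

definition is_chart :: "'a topology \<Rightarrow> ('a, 'n::finite) chart \<Rightarrow> bool" where
  "is_chart M c \<longleftrightarrow> openin M (fst c) \<and> open (coord_dom c) \<and>
     homeomorphic_map (subtopology M (fst c)) (top_of_set (coord_dom c)) (snd c)"

definition oriented_Cr_atlas :: "nat \<Rightarrow> 'a topology \<Rightarrow> ('a, 'n::finite) chart set \<Rightarrow> bool" where
  "oriented_Cr_atlas r M \<A> \<longleftrightarrow>
     (\<forall>c\<in>\<A>. is_chart M c) \<and>
     (\<Union>c\<in>\<A>. fst c) = topspace M \<and>
     (\<forall>c\<in>\<A>. \<forall>d\<in>\<A>.
        let T = in_coords c (snd d); D = snd c ` (fst c \<inter> fst d)
        in Ck_on r T D \<and> (\<forall>u\<in>D. det (matrix (frechet_derivative T (at u))) > 0))"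

definition oriented_connected_manifold ::
    "nat \<Rightarrow> 'a topology \<Rightarrow> ('a, 'n::finite) chart set \<Rightarrow> bool" where
  "oriented_connected_manifold r M \<A> \<longleftrightarrow>
     Hausdorff_space M \<and> second_countable M \<and> connected_space M \<and> oriented_Cr_atlas r M \<A>"

definition Cr_map ::
    "nat \<Rightarrow> ('a, 'n::finite) chart set \<Rightarrow> ('a \<Rightarrow> 'b::real_normed_vector) \<Rightarrow> bool" where
  "Cr_map r \<A> f \<longleftrightarrow> (\<forall>c\<in>\<A>. Ck_on r (in_coords c f) (coord_dom c))"

section \<open>Relative differential geometry in local coordinates\<close>

text \<open>
  The ambient space of dimension \<open>CARD('n) + 1\<close> is \<open>real^('n option)\<close>.  Below, \<open>F\<close> and \<open>Y\<close> are the
  coordinate representations of the immersion and of the relative normalization.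
\<close>

definition frame ::
    "(real^'n::finite \<Rightarrow> real^('n option)) \<Rightarrow> real^'n \<Rightarrow> real^('n option) \<Rightarrow> real^('n option)^('n option)"
  where "frame F u w = (\<chi> a. case a of None \<Rightarrow> w | Some i \<Rightarrow> pd i F u)"

text \<open>
  The rows of \<open>frame\<close> and the ambient coordinates have the same index type, so the sign of
  the determinant does not depend on an ordering of the indices.
\<close>

definition unit_normal :: "(real^'n::finite \<Rightarrow> real^('n option)) \<Rightarrow> real^'n \<Rightarrow> real^('n option)" where
  "unit_normal F u =
     (THE \<nu>. norm \<nu> = 1 \<and> (\<forall>i. \<nu> \<bullet> pd i F u = 0) \<and> det (frame F u \<nu>) > 0)"

definition first_form :: "(real^'n::finite \<Rightarrow> real^('n option)) \<Rightarrow> real^'n \<Rightarrow> real^'n^'n" where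
  "first_form F u = (\<chi> i j. pd i F u \<bullet> pd j F u)"

definition second_form :: "(real^'n::finite \<Rightarrow> real^('n option)) \<Rightarrow> real^'n \<Rightarrow> real^'n^'n" where
  "second_form F u = (\<chi> i j. unit_normal F u \<bullet> pd j (pd i F) u)"

definition gauss_curvature :: "(real^'n::finite \<Rightarrow> real^('n option)) \<Rightarrow> real^'n \<Rightarrow> real" where
  "gauss_curvature F u = det (second_form F u) / det (first_form F u)"

context
  fixes F Y :: "real^'n::finite \<Rightarrow> real^('n option)"
begin

definition support_function :: "real^'n \<Rightarrow> real" where
  "support_function u = unit_normal F u \<bullet> Y u"

definition covector :: "real^'n \<Rightarrow> real^('n option)" where
  "covector u = inverse (support_function u) *\<^sub>R unit_normal F u"

definition rel_metric :: "real^'n \<Rightarrow> real^'n^'n" where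
  "rel_metric u = (\<chi> i j. covector u \<bullet> pd j (pd i F) u)"

definition rel_metric_inv :: "real^'n \<Rightarrow> real^'n^'n" where
  "rel_metric_inv u = matrix_inv (rel_metric u)"

definition christoffel :: "'n \<Rightarrow> 'n \<Rightarrow> 'n \<Rightarrow> real^'n \<Rightarrow> real" where
  "christoffel m i j u = (1/2) * (\<Sum>l\<in>UNIV. rel_metric_inv u $ m $ l *
      (pd i (\<lambda>v. rel_metric v $ j $ l) u + pd j (\<lambda>v. rel_metric v $ i $ l) u
       - pd l (\<lambda>v. rel_metric v $ i $ j) u))"

definition cov_deriv2 :: "'n \<Rightarrow> 'n \<Rightarrow> real^'n \<Rightarrow> real^('n option)" where
  "cov_deriv2 j k u = pd k (pd j F) u - (\<Sum>m\<in>UNIV. christoffel m k j u *\<^sub>R pd m F u)"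

text \<open>
  For an immersion of class \<open>C\<^sup>3\<close> the Christoffel symbols are in general only continuous, so
  \<open>cov_deriv2 j k\<close> need not be differentiable.  Its second covariant derivative is paired with
  the covector at \<open>u\<close>; taking this pairing, with the covector frozen at \<open>u\<close>, before
  differentiating gives the same number where both make sense, and it makes sense already for \<open>C\<^sup>3\<close>:
  the products of Christoffel symbols with the scalars \<open>covector u \<bullet> pd m F v\<close>, which vanish
  at \<open>v = u\<close>, are differentiable at \<open>u\<close>.
\<close>

definition darboux :: "'n \<Rightarrow> 'n \<Rightarrow> 'n \<Rightarrow> real^'n \<Rightarrow> real" where
  "darboux j k l u = pd l (\<lambda>v. covector u \<bullet> cov_deriv2 j k v) u
     - (\<Sum>m\<in>UNIV. christoffel m l j u * (covector u \<bullet> cov_deriv2 m k u))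
     - (\<Sum>m\<in>UNIV. christoffel m l k u * (covector u \<bullet> cov_deriv2 j m u))"

definition darboux_up :: "'n \<Rightarrow> 'n \<Rightarrow> 'n \<Rightarrow> real^'n \<Rightarrow> real" where
  "darboux_up j k l u = (\<Sum>a\<in>UNIV. \<Sum>b\<in>UNIV. \<Sum>c\<in>UNIV.
     rel_metric_inv u $ j $ a * rel_metric_inv u $ k $ b * rel_metric_inv u $ l $ c * darboux a b c u)"

definition pick_invariant :: "real^'n \<Rightarrow> real" where
  "pick_invariant u = 1 / (real CARD('n) * (real CARD('n) - 1)) *
     (\<Sum>j\<in>UNIV. \<Sum>k\<in>UNIV. \<Sum>l\<in>UNIV. darboux j k l u * darboux_up j k l u)"

end

section \<open>Hypersurfaces and relative normalizations\<close>

definition immersion_at :: "(real^'n::finite \<Rightarrow> real^('n option)) \<Rightarrow> real^'n \<Rightarrow> bool" where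
  "immersion_at F u \<longleftrightarrow> inj (frechet_derivative F (at u))"

definition hypersurface ::
    "nat \<Rightarrow> 'a topology \<Rightarrow> ('a, 'n::finite) chart set \<Rightarrow> ('a \<Rightarrow> real^('n option)) \<Rightarrow> bool" where
  "hypersurface r M \<A> x \<longleftrightarrow>
     oriented_connected_manifold r M \<A> \<and> Cr_map r \<A> x \<and>
     (\<forall>c\<in>\<A>. \<forall>u\<in>coord_dom c. immersion_at (in_coords c x) u \<and> gauss_curvature (in_coords c x) u \<noteq> 0)"

definition positive_gauss_curvature ::
    "('a, 'n::finite) chart set \<Rightarrow> ('a \<Rightarrow> real^('n option)) \<Rightarrow> bool" where
  "positive_gauss_curvature \<A> x \<longleftrightarrow>
     (\<forall>c\<in>\<A>. \<forall>u\<in>coord_dom c. gauss_curvature (in_coords c x) u > 0)"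

text \<open>
  In dimension 2 a positive Gaussian curvature makes the second fundamental form definite.  In
  dimension at least 3 it does not, and a vanishing Pick invariant then does not force the Darboux
  tensor to vanish: the graph of \<open>x1 x2 + x3 x4 + x1^3\<close> over 4-space, with the constant vertical
  vector field as normalization, has positive Gaussian curvature and vanishing Pick invariant,
  but lies in no hyperquadric.
\<close>

definition definite_second_form ::
    "('a, 'n::finite) chart set \<Rightarrow> ('a \<Rightarrow> real^('n option)) \<Rightarrow> bool" where
  "definite_second_form \<A> x \<longleftrightarrow>
     (\<forall>c\<in>\<A>. \<forall>u\<in>coord_dom c. let h = second_form (in_coords c x) u in
        (\<forall>v. v \<noteq> 0 \<longrightarrow> v \<bullet> (h *v v) > 0) \<or> (\<forall>v. v \<noteq> 0 \<longrightarrow> v \<bullet> (h *v v) < 0))"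

definition relative_normalization ::
    "nat \<Rightarrow> ('a, 'n::finite) chart set \<Rightarrow> ('a \<Rightarrow> real^('n option)) \<Rightarrow> ('a \<Rightarrow> real^('n option)) \<Rightarrow> bool" where
  "relative_normalization s \<A> x y \<longleftrightarrow> Cr_map s \<A> y \<and>
     (\<forall>c\<in>\<A>. \<forall>u\<in>coord_dom c. let F = in_coords c x; Y = in_coords c y in
        (\<forall>a b. (\<Sum>i\<in>UNIV. a i *\<^sub>R pd i F u) + b *\<^sub>R Y u = 0 \<longrightarrow> (\<forall>i. a i = 0) \<and> b = 0) \<and>
        (\<forall>i. pd i Y u \<in> span (range (\<lambda>j. pd j F u))))"

definition positive_support ::
    "('a, 'n::finite) chart set \<Rightarrow> ('a \<Rightarrow> real^('n option)) \<Rightarrow> ('a \<Rightarrow> real^('n option)) \<Rightarrow> bool" where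
  "positive_support \<A> x y \<longleftrightarrow>
     (\<forall>c\<in>\<A>. \<forall>u\<in>coord_dom c. support_function (in_coords c x) (in_coords c y) u > 0)"

definition vanishing_pick_invariant ::
    "('a, 'n::finite) chart set \<Rightarrow> ('a \<Rightarrow> real^('n option)) \<Rightarrow> ('a \<Rightarrow> real^('n option)) \<Rightarrow> bool" where
  "vanishing_pick_invariant \<A> x y \<longleftrightarrow>
     (\<forall>c\<in>\<A>. \<forall>u\<in>coord_dom c. pick_invariant (in_coords c x) (in_coords c y) u = 0)"

definition equiaffine_normalization ::
    "nat \<Rightarrow> ('a, 'n::finite) chart set \<Rightarrow> ('a \<Rightarrow> real^('n option)) \<Rightarrow> ('a \<Rightarrow> real^('n option)) \<Rightarrow> bool" where
  "equiaffine_normalization s \<A> x y \<longleftrightarrow> relative_normalization s \<A> x y \<and>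
     (\<forall>c\<in>\<A>. \<forall>u\<in>coord_dom c. support_function (in_coords c x) (in_coords c y) u =
        \<bar>gauss_curvature (in_coords c x) u\<bar> powr (1 / (real CARD('n) + 2)))"

definition constantly_proportional ::
    "('a, 'n::finite) chart set \<Rightarrow> ('a \<Rightarrow> real^('n option)) \<Rightarrow> ('a \<Rightarrow> real^('n option)) \<Rightarrow>
       ('a \<Rightarrow> real^('n option)) \<Rightarrow> bool" where
  "constantly_proportional \<A> x y z \<longleftrightarrow> (\<exists>k::real. k \<noteq> 0 \<and>
     (\<forall>c\<in>\<A>. \<forall>u\<in>coord_dom c. support_function (in_coords c x) (in_coords c y) u =
        k * support_function (in_coords c x) (in_coords c z) u))"

text \<open>
  The symmetry of \<open>A\<close> is essential: without it, \<open>A \<noteq> 0\<close> would not exclude hyperplanes.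
\<close>

definition hyperquadric :: "(real^'m::finite) set \<Rightarrow> bool" where
  "hyperquadric Q \<longleftrightarrow> (\<exists>(A::real^'m^'m) b k. transpose A = A \<and> A \<noteq> 0 \<and>
     Q = {v. v \<bullet> (A *v v) + b \<bullet> v + k = 0})"

end

theory Submission
  imports Defs
begin

text \<open>
  Let \<open>X\<close> be the covector and \<open>G\<close> the relative metric.  Definiteness turns the vanishing of the Pick
  invariant into the vanishing of the Darboux tensor, which says that the connection induced by the
  normalization \<open>Y\<close> is the Levi-Civita connection of \<open>G\<close>.  Commuting the second derivatives of \<open>G\<close>
  then gives \<open>Y\<^sub>i = - \<lambda> F\<^sub>i\<close>.  As \<open>Y\<close> is only of class \<open>C\<^sup>1\<close>, this cannot be differentiated to see that
  \<open>\<lambda>\<close> is constant; instead one uses local coordinates that are affine functions of \<open>F\<close>.  The symmetric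
  matrix \<open>A\<close> with \<open>A F\<^sub>i = - X\<^sub>i\<close> and \<open>A Y = \<lambda> X\<close> has vanishing derivative, and so has \<open>b = - X - A F\<close>;
  thus \<open>F\<close> lies in the quadric \<open>v \<bullet> A v + 2 b \<bullet> v + k = 0\<close>.  The normalization \<open>(A F + b) \<bullet> Y = - 1\<close>
  does not refer to coordinates and makes \<open>(A, b, k)\<close> unique, so by connectedness a single quadric
  contains the hypersurface.  Writing the form \<open>(A, b, k)\<close> in the frame of \<open>F\<close>, \<open>F\<^sub>i\<close> and \<open>Y\<close> shows that
  \<open>|K| = |det (A, b, k)| q^(n + 2)\<close>, hence the support function \<open>q\<close> is a constant multiple of
  \<open>|K|^(1 / (n + 2))\<close>.
\<close>

section \<open>Partial derivatives\<close>

text \<open>Regularity is the obstacle. With \<open>F\<close> of class C^3 and \<open>Y\<close> of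
  class C^1, the metric \<open>G\<close> is a priori only once differentiable, because its first
  derivatives contain third derivatives of \<open>F\<close>. Two facts recover the missing order.
  The derivative of \<open>X\<close> is a combination of the dual frame with coefficients from
  \<open>G\<close>, in which no derivative of \<open>Y\<close> occurs, so \<open>X\<close> is twice
  differentiable. Once the Darboux tensor vanishes, the third derivatives of \<open>F\<close> can be
  eliminated from the derivative of \<open>G\<close>, which leaves products of differentiable
  functions. Only then may second derivatives of \<open>G\<close> be commuted. The matrix
  \<open>A\<close> is dictated by the goal: half the gradient of the quadric is
  \<open>A F + b\<close>, a normal vector, and scaling it to \<open>- X\<close> forces
  \<open>A F\<^sub>i = - X\<^sub>i\<close>. The value \<open>\<lambda> X\<close> at \<open>Y\<close>
  is consistent with this, as
  \<open>A Y\<^sub>i = - \<lambda> A F\<^sub>i = \<lambda> X\<^sub>i\<close>. In the exponent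
  \<open>n + 2\<close>, the power \<open>n\<close> comes from \<open>h = q G\<close> and the 2 from
  the determinant of the frame.\<close>

lemma pd_at:
  assumes "(f has_derivative f') (at u)"
  shows "pd i f u = f' (axis i 1)"
  using frechet_derivative_at[OF assms] by (simp add: pd_def)

lemma has_derivative_pd:
  assumes "f differentiable (at u)"
  shows "(f has_derivative (\<lambda>h. \<Sum>i\<in>UNIV. h $ i *\<^sub>R pd i f u)) (at u)"
proof -
  obtain f' where f': "(f has_derivative f') (at u)"
    using assms by (auto simp: differentiable_def)
  interpret f': bounded_linear f' using f' by (rule has_derivative_bounded_linear)
  have "f' h = (\<Sum>i\<in>UNIV. h $ i *\<^sub>R pd i f u)" for h
  proof -
    have "f' h = f' (\<Sum>i\<in>UNIV. h $ i *\<^sub>R axis i 1)"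
      using basis_expansion[of h] by (simp add: scalar_mult_eq_scaleR)
    then show ?thesis by (simp add: f'.sum f'.scaleR pd_at[OF f'])
  qed
  then have "f' = (\<lambda>h. \<Sum>i\<in>UNIV. h $ i *\<^sub>R pd i f u)" by (rule ext)
  then show ?thesis using f' by simp
qed

text \<open>\<open>frechet_derivative\<close> chooses among the derivatives at \<open>u\<close>, and
  functions that agree near \<open>u\<close> have the same ones; so the choices agree even where no
  derivative exists.\<close>

lemma pd_transform:
  assumes "open S" "u \<in> S" "\<And>v. v \<in> S \<Longrightarrow> f v = g v"
  shows "pd i f u = pd i g u"
  unfolding pd_def frechet_derivative_def
  using has_derivative_transform_within_open[OF _ assms(1,2), where t = UNIV]
  by (metis assms(3))

lemma differentiable_transform_open:
  assumes "f differentiable (at u)" "open S" "u \<in> S" "\<And>v. v \<in> S \<Longrightarrow> f v = g v"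
  shows "g differentiable (at u)"
  using has_derivative_transform_within_open[OF _ assms(2,3), where t = UNIV and f = f and g = g]
    assms(1,4) by (auto simp: differentiable_def)

lemma pd_const [simp]: "pd i (\<lambda>v. c) u = 0"
  by (simp add: pd_at[where f' = "\<lambda>_. 0"])

lemma pd_zero_on:
  assumes "open S" "u \<in> S" "\<And>v. v \<in> S \<Longrightarrow> f v = c"
  shows "pd i f u = 0"
  using pd_transform[OF assms, where i = i] by simp

lemma pd_bounded_bilinear:
  assumes "bounded_bilinear prd" "f differentiable (at u)" "g differentiable (at u)"
  shows "pd i (\<lambda>v. prd (f v) (g v)) u = prd (f u) (pd i g u) + prd (pd i f u) (g u)"
    and "(\<lambda>v. prd (f v) (g v)) differentiable (at u)"
proof -
  note * = bounded_bilinear.FDERIV[OF assms(1) assms(2,3)[unfolded frechet_derivative_works]]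
  show "pd i (\<lambda>v. prd (f v) (g v)) u = prd (f u) (pd i g u) + prd (pd i f u) (g u)"
    using pd_at[OF *] by (simp add: pd_def)
  show "(\<lambda>v. prd (f v) (g v)) differentiable (at u)"
    using * unfolding differentiable_def by blast
qed

lemmas pd_inner = pd_bounded_bilinear[OF bounded_bilinear_inner]
lemmas pd_scaleR = pd_bounded_bilinear[OF bounded_bilinear_scaleR]

lemma pd_bounded_linear:
  assumes "bounded_linear L" "f differentiable (at u)"
  shows "pd i (\<lambda>v. L (f v)) u = L (pd i f u)"
    and "(\<lambda>v. L (f v)) differentiable (at u)"
proof -
  note * = bounded_linear.has_derivative[OF assms(1) assms(2)[unfolded frechet_derivative_works]]
  show "pd i (\<lambda>v. L (f v)) u = L (pd i f u)"
    using pd_at[OF *] by (simp add: pd_def)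
  show "(\<lambda>v. L (f v)) differentiable (at u)"
    using * unfolding differentiable_def by blast
qed

lemma pd_add:
  assumes "f differentiable (at u)" "g differentiable (at u)"
  shows "pd i (\<lambda>v. f v + g v) u = pd i f u + pd i g u"
  using pd_at[OF has_derivative_add[OF assms[unfolded frechet_derivative_works]]]
  by (simp add: pd_def)

lemma pd_diff:
  assumes "f differentiable (at u)" "g differentiable (at u)"
  shows "pd i (\<lambda>v. f v - g v) u = pd i f u - pd i g u"
  using pd_at[OF has_derivative_diff[OF assms[unfolded frechet_derivative_works]]]
  by (simp add: pd_def)

lemma pd_minus:
  assumes "f differentiable (at u)"
  shows "pd i (\<lambda>v. - f v) u = - pd i f u"
  using pd_at[OF has_derivative_minus[OF assms[unfolded frechet_derivative_works]]]
  by (simp add: pd_def)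

lemma pd_sum:
  assumes "\<And>k. k \<in> I \<Longrightarrow> f k differentiable (at u)"
  shows "pd i (\<lambda>v. \<Sum>k\<in>I. f k v) u = (\<Sum>k\<in>I. pd i (f k) u)"
  using pd_at[OF has_derivative_sum[of I f "\<lambda>k. frechet_derivative (f k) (at u)" "at u"]] assms
  by (simp add: pd_def frechet_derivative_works)

lemma differentiable_sum_UNIV:
  assumes "\<And>k. f k differentiable (at u)"
  shows "(\<lambda>v. \<Sum>k\<in>(UNIV::'k::finite set). f k v) differentiable (at u)"
  using assms by (intro differentiable_sum) auto

text \<open>The split \<open>f g - f(u) L = f (g - L) + (f - f(u)) L\<close>, with \<open>L\<close>
  the linear part of \<open>g\<close>, has a remainder of small order as soon as \<open>f\<close> is
  continuous. It serves the Christoffel symbols, known to be continuous only, multiplied by the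
  functions \<open>covector u \<bullet> pd m F v\<close>, which vanish at
  \<open>v = u\<close>.\<close>

lemma pd_mult_vanishing:
  fixes f g :: "real^'n::finite \<Rightarrow> real"
  assumes "continuous (at u) f" "g differentiable (at u)" "g u = 0"
  shows "pd i (\<lambda>v. f v * g v) u = f u * pd i g u"
    and "(\<lambda>v. f v * g v) differentiable (at u)"
proof -
  obtain L where L: "(g has_derivative L) (at u)"
    using assms(2) by (auto simp: differentiable_def)
  then have bl: "bounded_linear L" by (rule has_derivative_bounded_linear)
  obtain C where C: "\<And>h. norm (L h) \<le> norm h * C" "C > 0"
    using bounded_linear.pos_bounded[OF bl] by blast
  have gL: "((\<lambda>y. norm (g y - g u - L (y - u)) / norm (y - u)) \<longlongrightarrow> 0) (at u)"
    using L by (auto simp: has_derivative_iff_norm)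
  have fc: "(f \<longlongrightarrow> f u) (at u)"
    using assms(1) by (simp add: continuous_at)
  have "((\<lambda>y. \<bar>f y\<bar> * (norm (g y - g u - L (y - u)) / norm (y - u)) + \<bar>f y - f u\<bar> * C) \<longlongrightarrow>
      \<bar>f u\<bar> * 0 + \<bar>f u - f u\<bar> * C) (at u)"
    by (intro tendsto_intros fc gL)
  then have lim: "((\<lambda>y. \<bar>f y\<bar> * (norm (g y - g u - L (y - u)) / norm (y - u)) + \<bar>f y - f u\<bar> * C)
      \<longlongrightarrow> 0) (at u)" by simp
  have "((\<lambda>y. norm (f y * g y - f u * g u - f u * L (y - u)) / norm (y - u)) \<longlongrightarrow> 0) (at u)"
  proof (rule tendsto_sandwich[OF _ _ tendsto_const lim])
    show "\<forall>\<^sub>F y in at u. norm (f y * g y - f u * g u - f u * L (y - u)) / norm (y - u)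
        \<le> \<bar>f y\<bar> * (norm (g y - g u - L (y - u)) / norm (y - u)) + \<bar>f y - f u\<bar> * C"
    proof (rule eventually_at_filter[THEN iffD2, OF always_eventually], intro allI impI)
      fix y assume "y \<noteq> u"
      have "f y * g y - f u * g u - f u * L (y - u)
          = f y * (g y - g u - L (y - u)) + (f y - f u) * L (y - u)"
        using assms(3) by (simp add: algebra_simps)
      then have "norm (f y * g y - f u * g u - f u * L (y - u))
          \<le> \<bar>f y\<bar> * norm (g y - g u - L (y - u)) + \<bar>f y - f u\<bar> * norm (L (y - u))"
        by (metis norm_triangle_ineq norm_mult real_norm_def)
      also have "\<dots> \<le> \<bar>f y\<bar> * norm (g y - g u - L (y - u)) + \<bar>f y - f u\<bar> * (norm (y - u) * C)"
        using C(1) by (intro add_left_mono mult_left_mono) auto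
      finally show "norm (f y * g y - f u * g u - f u * L (y - u)) / norm (y - u)
        \<le> \<bar>f y\<bar> * (norm (g y - g u - L (y - u)) / norm (y - u)) + \<bar>f y - f u\<bar> * C"
        using \<open>y \<noteq> u\<close> by (simp add: field_simps)
    qed
  qed simp
  then have *: "((\<lambda>v. f v * g v) has_derivative (\<lambda>h. f u * L h)) (at u)"
    using bounded_linear_const_mult[OF bl] by (simp add: has_derivative_iff_norm)
  show "pd i (\<lambda>v. f v * g v) u = f u * pd i g u"
    using pd_at[OF *] pd_at[OF L] by simp
  show "(\<lambda>v. f v * g v) differentiable (at u)"
    using * unfolding differentiable_def by blast
qed

text \<open>The mean value theorem in direction \<open>i\<close>, applied to the difference in
  direction \<open>j\<close>, turns the double difference quotient into a difference of values of
  \<open>pd i f\<close>; differentiability of \<open>pd i f\<close> at the single point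
  \<open>u\<close> then gives the limit. The quotient is symmetric in \<open>i\<close> and
  \<open>j\<close>, which is the source of \<open>pd_commute\<close>.\<close>

lemma pd_commute_limit:
  fixes f :: "real^'n::finite \<Rightarrow> real"
  assumes "open S" "u \<in> S" and f: "\<And>v. v \<in> S \<Longrightarrow> f differentiable (at v)"
    and g: "pd i f differentiable (at u)"
  shows "((\<lambda>t. (f (u + t *\<^sub>R axis i 1 + t *\<^sub>R axis j 1) - f (u + t *\<^sub>R axis i 1)
      - f (u + t *\<^sub>R axis j 1) + f u) / t\<^sup>2) \<longlongrightarrow> pd j (pd i f) u) (at_right 0)"
    (is "(?q \<longlongrightarrow> ?l) _")
proof (rule tendstoI)
  fix \<epsilon>' :: real assume "\<epsilon>' > 0"
  \<comment> \<open>The two errors below add up to \<open>3 * \<epsilon> * t\<close>, so a quarter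
    of \<open>\<epsilon>'\<close> yields a strict inequality.\<close>
  define \<epsilon> where "\<epsilon> = \<epsilon>' / 4"
  have "\<epsilon> > 0" using \<open>\<epsilon>' > 0\<close> by (simp add: \<epsilon>_def)
  let ?g = "pd i f" and ?ei = "axis i 1 :: real^'n" and ?ej = "axis j 1 :: real^'n"
  obtain L where L: "(?g has_derivative L) (at u)"
    using g by (auto simp: differentiable_def)
  interpret L: bounded_linear L using L by (rule has_derivative_bounded_linear)
  have Lj: "L ?ej = ?l" by (simp add: pd_at[OF L])
  obtain d where "d > 0" and d: "\<And>v. norm (v - u) < d \<Longrightarrow> \<bar>?g v - ?g u - L (v - u)\<bar> \<le> \<epsilon> * norm (v - u)"
    using L \<open>\<epsilon> > 0\<close> unfolding has_derivative_at_alt by (metis real_norm_def)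
  obtain d' where "d' > 0" and d': "ball u d' \<subseteq> S"
    using assms(1,2) open_contains_ball by blast
  \<comment> \<open>Steps of length at most \<open>t\<close> in both directions move by at most
    \<open>2 * t\<close>, which must stay below both radii.\<close>
  define D where "D = min d d' / 2"
  have "D > 0" using \<open>d > 0\<close> \<open>d' > 0\<close> by (simp add: D_def)
  have "dist (?q t) ?l < \<epsilon>'" if t: "0 < t" "t < D" for t
  proof -
    define \<phi> where "\<phi> s = f (u + s *\<^sub>R ?ei + t *\<^sub>R ?ej) - f (u + s *\<^sub>R ?ei)" for s
    define \<phi>' where "\<phi>' s = ?g (u + s *\<^sub>R ?ei + t *\<^sub>R ?ej) - ?g (u + s *\<^sub>R ?ei)" for s
    have nrm: "norm (s *\<^sub>R ?ei + t *\<^sub>R ?ej) \<le> s + t" "norm (s *\<^sub>R ?ei) \<le> s" if "0 \<le> s" for s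
      using that t norm_triangle_ineq[of "s *\<^sub>R ?ei" "t *\<^sub>R ?ej"] by auto
    have deriv: "(\<phi> has_real_derivative \<phi>' s) (at s)" if s: "0 \<le> s" "s \<le> t" for s
    proof -
      have line: "((\<lambda>s. f (w + s *\<^sub>R ?ei)) has_real_derivative ?g (w + s *\<^sub>R ?ei)) (at s)"
        if w: "w + s *\<^sub>R ?ei \<in> S" for w
      proof -
        obtain f' where f': "(f has_derivative f') (at (w + s *\<^sub>R ?ei))"
          using f[OF w] by (auto simp: differentiable_def)
        have "((\<lambda>s. f (w + s *\<^sub>R ?ei)) has_derivative (\<lambda>h. f' (h *\<^sub>R ?ei))) (at s)"
          by (rule has_derivative_compose[where f = "\<lambda>s. w + s *\<^sub>R ?ei" and f' = "\<lambda>h. h *\<^sub>R ?ei", OF _ f'])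
            (auto intro!: derivative_eq_intros)
        moreover have "f' (h *\<^sub>R ?ei) = ?g (w + s *\<^sub>R ?ei) * h" for h
          using linear_cmul[OF has_derivative_linear[OF f']] pd_at[OF f', of i] by simp
        ultimately show ?thesis by (simp add: has_field_derivative_def)
      qed
      have "(u + t *\<^sub>R ?ej) + s *\<^sub>R ?ei \<in> S" "u + s *\<^sub>R ?ei \<in> S"
      proof -
        have "norm (s *\<^sub>R ?ei + t *\<^sub>R ?ej) < d'" "norm (s *\<^sub>R ?ei) < d'"
          using nrm[OF s(1)] s t by (auto simp: D_def)
        then have "u + (s *\<^sub>R ?ei + t *\<^sub>R ?ej) \<in> ball u d'" "u + s *\<^sub>R ?ei \<in> ball u d'"
          by (metis dist_add_cancel dist_0_norm mem_ball add.right_neutral)+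
        then show "(u + t *\<^sub>R ?ej) + s *\<^sub>R ?ei \<in> S" "u + s *\<^sub>R ?ei \<in> S"
          using d' by (auto simp: algebra_simps)
      qed
      from DERIV_diff[OF line[OF this(1)] line[OF this(2)]]
      show ?thesis by (simp add: \<phi>_def[abs_def] \<phi>'_def algebra_simps)
    qed
    obtain \<sigma> where \<sigma>: "0 < \<sigma>" "\<sigma> < t" "\<phi> t - \<phi> 0 = (t - 0) * \<phi>' \<sigma>"
      using MVT2[OF t(1), of \<phi> \<phi>'] deriv by auto
    have "norm (\<sigma> *\<^sub>R ?ei + t *\<^sub>R ?ej) \<le> 2 * t" "norm (\<sigma> *\<^sub>R ?ei) \<le> t"
      using nrm[of \<sigma>] \<sigma> by auto
    moreover have "2 * t < d" using t by (auto simp: D_def)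
    ultimately have n: "norm (\<sigma> *\<^sub>R ?ei + t *\<^sub>R ?ej) < d" "norm (\<sigma> *\<^sub>R ?ei) < d"
        "\<epsilon> * norm (\<sigma> *\<^sub>R ?ei + t *\<^sub>R ?ej) \<le> \<epsilon> * (2 * t)" "\<epsilon> * norm (\<sigma> *\<^sub>R ?ei) \<le> \<epsilon> * t"
      using \<open>\<epsilon> > 0\<close> t(1) by auto
    have e1: "\<bar>?g (u + (\<sigma> *\<^sub>R ?ei + t *\<^sub>R ?ej)) - ?g u - L (\<sigma> *\<^sub>R ?ei + t *\<^sub>R ?ej)\<bar> \<le> \<epsilon> * (2 * t)"
      by (rule order.trans[OF _ n(3)]) (use d[of "u + (\<sigma> *\<^sub>R ?ei + t *\<^sub>R ?ej)"] n(1) in simp)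
    have e2: "\<bar>?g (u + \<sigma> *\<^sub>R ?ei) - ?g u - L (\<sigma> *\<^sub>R ?ei)\<bar> \<le> \<epsilon> * t"
      by (rule order.trans[OF _ n(4)]) (use d[of "u + \<sigma> *\<^sub>R ?ei"] n(2) in simp)
    have "\<bar>\<phi>' \<sigma> - t * ?l\<bar> \<le> \<epsilon> * (3 * t)"
      using e1 e2 by (simp add: \<phi>'_def L.add L.scaleR Lj algebra_simps)
    also have "\<dots> < \<epsilon>' * t" using \<open>\<epsilon>' > 0\<close> t by (simp add: \<epsilon>_def)
    finally have "\<bar>\<phi>' \<sigma> / t - ?l\<bar> < \<epsilon>'"
      using t by (simp add: field_simps abs_if split: if_splits)
    moreover have "?q t = \<phi>' \<sigma> / t"
    proof -
      have "?q t = (\<phi> t - \<phi> 0) / t\<^sup>2" by (simp add: \<phi>_def algebra_simps)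
      then show ?thesis using \<sigma>(3) t by (simp add: power2_eq_square)
    qed
    ultimately show ?thesis by (simp add: dist_real_def)
  qed
  then show "\<forall>\<^sub>F t in at_right 0. dist (?q t) ?l < \<epsilon>'"
    using \<open>D > 0\<close> eventually_at_right by blast
qed

lemma pd_commute:
  fixes f :: "real^'n::finite \<Rightarrow> 'b::real_inner"
  assumes "open S" "u \<in> S" and f: "\<And>v. v \<in> S \<Longrightarrow> f differentiable (at v)"
    and g: "pd i f differentiable (at u)" "pd j f differentiable (at u)"
  shows "pd j (pd i f) u = pd i (pd j f) u"
proof -
  have "pd j (pd i f) u \<bullet> b = pd i (pd j f) u \<bullet> b" for b
  proof -
    let ?f = "\<lambda>v. f v \<bullet> b"
    note lin = pd_bounded_linear[OF bounded_linear_inner_left]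
    have p: "pd k f v \<bullet> b = pd k ?f v" if "v \<in> S" for k v
      using lin(1)[OF f[OF that]] by simp
    have d1: "pd k ?f differentiable (at u)" if "pd k f differentiable (at u)" for k
      by (rule differentiable_transform_open[OF lin(2)[OF that] assms(1,2) p])
    have d2: "pd l (pd k ?f) u = pd l (pd k f) u \<bullet> b" if "pd k f differentiable (at u)" for k l
      using pd_transform[OF assms(1,2), of "\<lambda>v. pd k f v \<bullet> b" "pd k ?f" l] p lin(1)[OF that] by simp
    let ?q = "\<lambda>t. (?f (u + t *\<^sub>R axis i 1 + t *\<^sub>R axis j 1) - ?f (u + t *\<^sub>R axis i 1)
      - ?f (u + t *\<^sub>R axis j 1) + ?f u) / t\<^sup>2"
    have l1: "(?q \<longlongrightarrow> pd j (pd i ?f) u) (at_right 0)"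
      by (rule pd_commute_limit[OF assms(1,2) lin(2)[OF f] d1[OF g(1)]])
    have l2: "(?q \<longlongrightarrow> pd i (pd j ?f) u) (at_right 0)"
      using pd_commute_limit[OF assms(1,2) lin(2)[OF f] d1[OF g(2)], where j = i]
      by (simp add: algebra_simps)
    show ?thesis
      using tendsto_unique[OF trivial_limit_at_right_real l1 l2] d2[OF g(1)] d2[OF g(2)] by simp
  qed
  then show ?thesis using vector_eq_rdot by blast
qed

section \<open>Closure properties of the class \<open>C\<^sup>k\<close>\<close>

lemma Ck_on_Suc_imp: "Ck_on (Suc k) f S \<Longrightarrow> Ck_on k f S"
proof (induction k arbitrary: f)
  case 0
  then show ?case
    by (auto intro!: differentiable_imp_continuous_on differentiable_at_imp_differentiable_on)
qed auto

lemma Ck_on_mono: "Ck_on k f S \<Longrightarrow> l \<le> k \<Longrightarrow> Ck_on l f S"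
  by (induction k) (auto simp del: Ck_on.simps dest: Ck_on_Suc_imp elim: le_SucE)

lemma Ck_on_transform:
  assumes "open S" "\<And>v. v \<in> S \<Longrightarrow> f v = g v" "Ck_on k f S"
  shows "Ck_on k g S"
  using assms(2,3)
proof (induction k arbitrary: f g)
  case 0
  then show ?case by (metis Ck_on.simps(1) continuous_on_cong)
next
  case (Suc k)
  have "g differentiable (at v)" if "v \<in> S" for v
    using differentiable_transform_open[OF _ assms(1) that Suc.prems(1)] Suc.prems(2) that by simp
  moreover have "Ck_on k (pd i g) S" for i
    by (rule Suc.IH[OF pd_transform[OF assms(1) _ Suc.prems(1)]]) (use Suc.prems(2) in auto)
  ultimately show ?case by simp
qed

lemma Ck_on_scaleR:
  assumes "open S" "Ck_on k f S"
  shows "Ck_on k (\<lambda>v. c *\<^sub>R f v) S"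
  using assms(2)
proof (induction k arbitrary: f)
  case 0
  then show ?case by (simp add: continuous_on_scaleR)
next
  case (Suc k)
  have p: "pd i (\<lambda>v. c *\<^sub>R f v) v = c *\<^sub>R pd i f v" "(\<lambda>v. c *\<^sub>R f v) differentiable (at v)" if "v \<in> S" for v i
    using pd_bounded_linear[OF bounded_linear_scaleR_right, of f v] Suc.prems that by auto
  have "Ck_on k (pd i (\<lambda>v. c *\<^sub>R f v)) S" for i
    by (rule Ck_on_transform[OF assms(1) p(1)[symmetric] Suc.IH]) (use Suc.prems in auto)
  then show ?case using p(2) by simp
qed

lemma pd_zero_imp_const:
  fixes f :: "real^'n::finite \<Rightarrow> 'b::real_normed_vector"
  assumes "open S" "connected S" "\<And>v. v \<in> S \<Longrightarrow> f differentiable (at v)"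
    "\<And>v i. v \<in> S \<Longrightarrow> pd i f v = 0" "v \<in> S" "w \<in> S"
  shows "f v = f w"
proof (rule has_derivative_zero_unique_connected[OF assms(1,2) _ assms(5,6)])
  fix z assume "z \<in> S"
  then show "(f has_derivative (\<lambda>h. 0)) (at z)"
    using has_derivative_pd[OF assms(3)] assms(4) by fastforce
qed

section \<open>Determinants and definite forms\<close>

lemma map_option_permutes:
  assumes "p permutes UNIV"
  shows "map_option p permutes UNIV"
proof -
  have "bij (map_option p)"
    by (rule o_bij[where g = "map_option (inv p)"])
      (use assms in \<open>auto simp: fun_eq_iff option.map_comp comp_def permutes_inverses option.map_ident\<close>)
  then show ?thesis by (rule bij_imp_permutes) auto
qed

text \<open>A transposition lifts to a transposition, so induction over products of transpositions
  compares the signs.\<close>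

lemma sign_map_option:
  fixes p :: "'n::finite \<Rightarrow> 'n"
  assumes "p permutes UNIV"
  shows "sign (map_option p) = sign p"
  using assms finite[of UNIV]
proof (induction p rule: permutes_induct[where S = UNIV])
  case id
  then show ?case by (simp only: option.map_id0 sign_id)
next
  case (swap a b p)
  have "map_option (Transposition.transpose a b \<circ> p) = Transposition.transpose (Some a) (Some b) \<circ> map_option p"
    by (auto simp: fun_eq_iff Transposition.transpose_def map_option_case split: option.split)
  then have "sign (map_option (Transposition.transpose a b \<circ> p))
      = sign (Transposition.transpose (Some a) (Some b)) * sign (map_option p)"
    using swap.hyps map_option_permutes
    by (metis sign_compose permutation_swap_id permutation_permutes finite)
  also have "\<dots> = sign (Transposition.transpose a b) * sign p"
    using swap by (simp add: sign_swap_id)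
  also have "\<dots> = sign (Transposition.transpose a b \<circ> p)"
    using swap.hyps by (metis sign_compose permutation_swap_id permutation_permutes finite)
  finally show ?case .
qed

lemma permutes_option_fixing_None:
  "{p. p permutes (UNIV :: 'n option set) \<and> p None = None} = map_option ` {p. p permutes UNIV}"
proof (intro equalityI subsetI)
  fix p :: "'n option \<Rightarrow> 'n option"
  assume "p \<in> {p. p permutes UNIV \<and> p None = None}"
  then have p: "bij p" "p None = None" by (auto simp: permutes_bij)
  then have inj: "inj p" and surj: "surj p" by (auto simp: bij_def)
  have Some: "p (Some i) \<noteq> None" for i
    using injD[OF inj, of "Some i" None] p(2) by auto
  define f where "f i = the (p (Some i))" for i
  have f: "p (Some i) = Some (f i)" for i using Some by (simp add: f_def)
  have "p x = map_option f x" for x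
    using p(2) f by (cases x) auto
  then have "p = map_option f" by (rule ext)
  moreover have "bij f"
  proof (rule bijI)
    show "inj f"
    proof (rule injI)
      fix i j assume "f i = f j"
      then show "i = j" using injD[OF inj, of "Some i" "Some j"] f by simp
    qed
    show "surj f"
      unfolding surj_def
    proof
      fix i
      obtain x where "Some i = p x" using surj by (auto simp: surj_def)
      then show "\<exists>j. i = f j" using p(2) f by (cases x) auto
    qed
  qed
  ultimately show "p \<in> map_option ` {p. p permutes UNIV}"
    by (intro image_eqI[of _ _ f]) (auto intro: bij_imp_permutes)
qed (auto simp: map_option_permutes)

text \<open>Only the permutations that fix \<open>None\<close> contribute, and these are exactly the
  \<open>map_option p\<close>, with the sign of \<open>p\<close>. Determinants of frames and of Gram
  matrices are computed with it.\<close>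

lemma det_option:
  fixes M :: "'a::comm_ring_1^('n::finite option)^('n option)"
  assumes "\<And>i. M $ None $ Some i = 0"
  shows "det M = M $ None $ None * det (\<chi> i j. M $ Some i $ Some j)"
proof -
  let ?t = "\<lambda>p. of_int (sign p) * (\<Prod>i\<in>UNIV. M $ i $ p i)"
  have "det M = (\<Sum>p | p permutes UNIV. ?t p)" by (simp add: det_def)
  also have "\<dots> = (\<Sum>p | p permutes UNIV \<and> p None = None. ?t p)"
  proof (rule sum.mono_neutral_right)
    show "\<forall>p\<in>{p. p permutes UNIV} - {p. p permutes UNIV \<and> p None = None}. ?t p = 0"
    proof
      fix p :: "'n option \<Rightarrow> 'n option"
      assume "p \<in> {p. p permutes UNIV} - {p. p permutes UNIV \<and> p None = None}"
      then obtain i where "p None = Some i" by auto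
      then have "M $ None $ p None = 0" using assms by simp
      then have "(\<Prod>i\<in>UNIV. M $ i $ p i) = 0" by (intro prod_zero) auto
      then show "?t p = 0" by simp
    qed
  qed (auto intro: finite_permutations)
  also have "\<dots> = (\<Sum>p | p permutes (UNIV :: 'n set). ?t (map_option p))"
    unfolding permutes_option_fixing_None
  proof (rule sum.reindex_cong[OF _ refl refl])
    show "inj_on map_option {p :: 'n \<Rightarrow> 'n. p permutes UNIV}"
      by (rule inj_onI, rule ext) (metis option.inject option.simps(9))
  qed
  also have "\<dots> = (\<Sum>p | p permutes (UNIV :: 'n set). M $ None $ None *
      (of_int (sign p) * (\<Prod>i\<in>UNIV. (\<chi> i j. M $ Some i $ Some j) $ i $ p i)))"
  proof (rule sum.cong[OF refl])
    fix p :: "'n \<Rightarrow> 'n" assume "p \<in> {p. p permutes UNIV}"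
    moreover have "(\<Prod>i\<in>UNIV. M $ i $ map_option p i) = M $ None $ None * (\<Prod>i\<in>UNIV. M $ Some i $ Some (p i))"
      by (simp add: UNIV_option_conv prod.reindex)
    ultimately show "?t (map_option p) = M $ None $ None *
      (of_int (sign p) * (\<Prod>i\<in>UNIV. (\<chi> i j. M $ Some i $ Some j) $ i $ p i))"
      by (simp add: sign_map_option mult_ac)
  qed
  finally show ?thesis by (simp add: det_def sum_distrib_left)
qed

lemma matrix_inv_mult:
  fixes A :: "real^'m::finite^'m"
  assumes "det A \<noteq> 0"
  shows "A ** matrix_inv A = mat 1" "matrix_inv A ** A = mat 1"
proof -
  have "\<exists>B. A ** B = mat 1 \<and> B ** A = mat 1"
    using assms by (simp add: invertible_det_nz flip: invertible_def)
  from someI_ex[OF this] show "A ** matrix_inv A = mat 1" "matrix_inv A ** A = mat 1"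
    by (simp_all add: matrix_inv_def)
qed

text \<open>Cramer's rule makes the entries of the inverse quotients of determinants; from this
  \<open>differentiable_matrix_inv\<close> obtains their differentiability.\<close>

lemma matrix_inv_cramer:
  fixes A :: "real^'m::finite^'m"
  assumes "det A \<noteq> 0"
  shows "matrix_inv A $ i $ j =
    det (\<chi> p q. if q = i then axis j 1 $ p else A $ p $ q) / det A"
proof -
  have "A ** matrix_inv A = mat 1"
    using assms by (rule matrix_inv_mult)
  then have "A *v column j (matrix_inv A) = axis j 1"
    by (simp add: vec_eq_iff matrix_vector_mult_def matrix_matrix_mult_def column_def mat_def axis_def)
  then have "column j (matrix_inv A) = (\<chi> k. det (\<chi> p q. if q = k then axis j 1 $ p else A $ p $ q) / det A)"
    using cramer[OF assms] by simp
  then show ?thesis by (simp add: vec_eq_iff column_def)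
qed

lemma differentiable_prod_finite:
  fixes f :: "'i \<Rightarrow> 'a::real_normed_vector \<Rightarrow> real"
  assumes "\<And>i. i \<in> I \<Longrightarrow> f i differentiable (at u)"
  shows "(\<lambda>v. \<Prod>i\<in>I. f i v) differentiable (at u)"
  using assms by (induction I rule: infinite_finite_induct) (auto intro: differentiable_mult)

lemma differentiable_det:
  fixes E :: "'a::real_normed_vector \<Rightarrow> real^'m::finite^'m"
  assumes "\<And>i j. (\<lambda>v. E v $ i $ j) differentiable (at u)"
  shows "(\<lambda>v. det (E v)) differentiable (at u)"
  unfolding det_def
  by (intro differentiable_sum differentiable_mult differentiable_const finite_permutations finite ballI
      differentiable_prod_finite[of UNIV "\<lambda>i v. E v $ i $ _ i"] assms)

lemma differentiable_matrix_inv: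
  fixes E :: "'a::real_normed_vector \<Rightarrow> real^'m::finite^'m"
  assumes "open S" "u \<in> S" "\<And>v. v \<in> S \<Longrightarrow> det (E v) \<noteq> 0"
    and E: "\<And>i j. (\<lambda>v. E v $ i $ j) differentiable (at u)"
  shows "(\<lambda>v. matrix_inv (E v) $ i $ j) differentiable (at u)"
proof -
  have "(\<lambda>v. det (\<chi> p q. if q = i then axis j 1 $ p else E v $ p $ q) * inverse (det (E v))) differentiable (at u)"
  proof (intro differentiable_mult differentiable_inverse differentiable_det)
    fix p q
    show "(\<lambda>v. (\<chi> p q. if q = i then axis j 1 $ p else E v $ p $ q) $ p $ q) differentiable at u"
      by (cases "q = i") (auto intro: E)
  qed (use assms in auto)
  then obtain f' where "((\<lambda>v. det (\<chi> p q. if q = i then axis j 1 $ p else E v $ p $ q) * inverse (det (E v)))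
     has_derivative f') (at u)" by (auto simp: differentiable_def)
  from has_derivative_transform_within_open[OF this assms(1,2)]
  have "((\<lambda>v. matrix_inv (E v) $ i $ j) has_derivative f') (at u)"
    by (simp add: matrix_inv_cramer assms(3) divide_inverse)
  then show ?thesis by (auto simp: differentiable_def)
qed

text \<open>Completing the square in the variable \<open>s\<close> leaves the Schur complement on
  \<open>I\<close>, again positive definite; the recursion is the Cholesky factorization.\<close>

lemma positive_definite_gram:
  fixes P :: "'i \<Rightarrow> 'i \<Rightarrow> real"
  assumes "finite I"
    and "\<And>i j. P i j = P j i"
    and "\<And>v. (\<exists>i\<in>I. v i \<noteq> 0) \<Longrightarrow> (\<Sum>i\<in>I. \<Sum>j\<in>I. P i j * v i * v j) > 0"
  shows "\<exists>b. \<forall>i\<in>I. \<forall>j\<in>I. P i j = (\<Sum>m\<in>I. b m i * b m j)"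
  using assms
proof (induction I arbitrary: P rule: finite_induct)
  case empty
  then show ?case by simp
next
  case (insert s I)
  have ss: "P s s > 0"
  proof -
    have "(\<Sum>i\<in>insert s I. \<Sum>j\<in>insert s I. P i j * of_bool (i = s) * of_bool (j = s)) > 0"
      by (rule insert.prems(2)) auto
    moreover have "(\<Sum>i\<in>insert s I. \<Sum>j\<in>insert s I. P i j * of_bool (i = s) * of_bool (j = s)) = P s s"
      using insert.hyps by (simp add: sum.neutral of_bool_def)
    ultimately show ?thesis by simp
  qed
  define P' where "P' i j = P i j - P s i * P s j / P s s" for i j
  have "\<exists>b. \<forall>i\<in>I. \<forall>j\<in>I. P' i j = (\<Sum>m\<in>I. b m i * b m j)"
  proof (rule insert.IH)
    show "P' i j = P' j i" for i j
      using insert.prems(1)[of i j] by (simp add: P'_def)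
    fix v :: "'i \<Rightarrow> real" assume v: "\<exists>i\<in>I. v i \<noteq> 0"
    define t where "t = (\<Sum>i\<in>I. P s i * v i)"
    \<comment> \<open>This value of the variable \<open>s\<close> minimizes the form for given
      \<open>v\<close>, so the form at \<open>w\<close> equals the Schur complement
      \<open>P'\<close> at \<open>v\<close>.\<close>
    define w where "w i = (if i = s then - t / P s s else v i)" for i
    have ws: "w s = - t / P s s" and wI: "\<And>i. i \<in> I \<Longrightarrow> w i = v i"
      using insert.hyps by (auto simp: w_def)
    have sP: "(\<Sum>j\<in>I. P s j * w s * w j) = w s * t"
      by (simp add: t_def sum_distrib_left wI mult_ac)
    have sP': "(\<Sum>i\<in>I. P i s * w i * w s) = w s * t"
      by (simp add: t_def sum_distrib_left wI mult_ac insert.prems(1)[of _ s])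
    have "0 < (\<Sum>i\<in>insert s I. \<Sum>j\<in>insert s I. P i j * w i * w j)"
      using v insert.hyps by (intro insert.prems(2)) (auto simp: w_def)
    also have "\<dots> = P s s * w s * w s + 2 * w s * t + (\<Sum>i\<in>I. \<Sum>j\<in>I. P i j * w i * w j)"
      using insert.hyps sP sP' by (simp add: sum.distrib)
    also have "\<dots> = (\<Sum>i\<in>I. \<Sum>j\<in>I. P i j * v i * v j) - t * t / P s s"
      using ss wI by (simp add: ws field_simps)
    also have "t * t / P s s = (\<Sum>i\<in>I. \<Sum>j\<in>I. P s i * P s j / P s s * v i * v j)"
      by (simp add: t_def sum_product sum_divide_distrib mult_ac)
    finally show "0 < (\<Sum>i\<in>I. \<Sum>j\<in>I. P' i j * v i * v j)"
      by (simp add: P'_def sum_subtractf left_diff_distrib)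
  qed
  then obtain b where b: "\<And>i j. i \<in> I \<Longrightarrow> j \<in> I \<Longrightarrow> P' i j = (\<Sum>m\<in>I. b m i * b m j)" by blast
  define b' where "b' m i = (if m = s then P s i / sqrt (P s s) else if i = s then 0 else b m i)" for m i
  have "P i j = (\<Sum>m\<in>insert s I. b' m i * b' m j)" if ij: "i \<in> insert s I" "j \<in> insert s I" for i j
  proof -
    have "(\<Sum>m\<in>insert s I. b' m i * b' m j) = P s i * P s j / P s s + (\<Sum>m\<in>I. b' m i * b' m j)"
      using insert.hyps ss by (simp add: b'_def)
    moreover have "(\<Sum>m\<in>I. b' m i * b' m j) = (if i = s \<or> j = s then 0 else P' i j)"
    proof -
      have "(\<Sum>m\<in>I. b' m i * b' m j) = (\<Sum>m\<in>I. if i = s \<or> j = s then 0 else b m i * b m j)"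
        using insert.hyps by (intro sum.cong) (auto simp: b'_def)
      then show ?thesis using b ij by auto
    qed
    ultimately show ?thesis
      using ss insert.prems(1)[of i s] by (auto simp: P'_def)
  qed
  then show ?case by blast
qed

text \<open>With the factorization \<open>P = b\<^sup>T b\<close> the sum in \<open>zero\<close> is
  the sum of the squares of the components of \<open>T\<close> with \<open>b\<close> applied to each
  slot, and \<open>b\<close> is injective because \<open>P\<close> is positive definite. Here
  definiteness enters: an indefinite \<open>P\<close> would give squares of both signs.\<close>

lemma positive_definite_tensor_cube:
  fixes P :: "real^'n::finite^'n" and T :: "'n \<Rightarrow> 'n \<Rightarrow> 'n \<Rightarrow> real"
  assumes sym: "\<And>i j. P $ i $ j = P $ j $ i"
    and pos: "\<And>v. v \<noteq> 0 \<Longrightarrow> v \<bullet> (P *v v) > 0"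
    and zero: "(\<Sum>j\<in>UNIV. \<Sum>k\<in>UNIV. \<Sum>l\<in>UNIV. T j k l *
      (\<Sum>a\<in>UNIV. \<Sum>b\<in>UNIV. \<Sum>c\<in>UNIV. P $ j $ a * P $ k $ b * P $ l $ c * T a b c)) = 0"
  shows "T j k l = 0"
proof -
  have qf: "v \<bullet> (P *v v) = (\<Sum>i\<in>UNIV. \<Sum>j\<in>UNIV. P $ i $ j * v $ i * v $ j)" for v
    by (simp add: inner_vec_def matrix_vector_mult_def sum_distrib_left mult_ac)
  have "\<exists>b. \<forall>i\<in>UNIV. \<forall>j\<in>UNIV. P $ i $ j = (\<Sum>m\<in>(UNIV::'n set). b m i * b m j)"
  proof (rule positive_definite_gram)
    fix v :: "'n \<Rightarrow> real" assume "\<exists>i\<in>UNIV. v i \<noteq> 0"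
    then have "(\<chi> i. v i) \<noteq> 0" by (auto simp: vec_eq_iff)
    from pos[OF this] show "0 < (\<Sum>i\<in>UNIV. \<Sum>j\<in>UNIV. P $ i $ j * v i * v j)"
      by (simp add: qf)
  qed (use sym in auto)
  then obtain b :: "'n \<Rightarrow> 'n \<Rightarrow> real" where b: "\<And>i j. P $ i $ j = (\<Sum>m\<in>UNIV. b m i * b m j)" by blast
  have inj: "a i = 0" if "\<And>m. (\<Sum>j\<in>UNIV. b m j * a j) = 0" for a :: "'n \<Rightarrow> real" and i
  proof (rule ccontr)
    assume "a i \<noteq> 0"
    then have "(\<chi> i. a i) \<noteq> 0" by (auto simp: vec_eq_iff)
    from pos[OF this] have "0 < (\<Sum>i\<in>UNIV. \<Sum>j\<in>UNIV. P $ i $ j * a i * a j)" by (simp add: qf)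
    also have "\<dots> = (\<Sum>i\<in>UNIV. \<Sum>j\<in>UNIV. \<Sum>m\<in>UNIV. (b m i * a i) * (b m j * a j))"
      by (simp add: b sum_distrib_left sum_distrib_right mult_ac)
    also have "\<dots> = (\<Sum>i\<in>UNIV. \<Sum>m\<in>UNIV. (b m i * a i) * (\<Sum>j\<in>UNIV. b m j * a j))"
      by (subst sum.swap) (simp add: sum_distrib_left)
    also have "\<dots> = 0" using that by simp
    finally show False by simp
  qed
  define S where "S m m' m'' = (\<Sum>j\<in>UNIV. b m j * (\<Sum>k\<in>UNIV. b m' k * (\<Sum>l\<in>UNIV. b m'' l * T j k l)))" for m m' m''
  have "(\<Sum>j\<in>UNIV. \<Sum>k\<in>UNIV. \<Sum>l\<in>UNIV. T j k l *
      (\<Sum>a\<in>UNIV. \<Sum>b\<in>UNIV. \<Sum>c\<in>UNIV. P $ j $ a * P $ k $ b * P $ l $ c * T a b c))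
    = (\<Sum>m\<in>UNIV. \<Sum>m'\<in>UNIV. \<Sum>m''\<in>UNIV. (S m m' m'')\<^sup>2)" (is "?lhs = _")
  proof -
    \<comment> \<open>Contraction of one slot: \<open>P\<close> is replaced by \<open>b\<close>
      applied to both factors.\<close>
    have gram: "(\<Sum>j\<in>UNIV. f j * (\<Sum>a\<in>UNIV. P $ j $ a * g a))
        = (\<Sum>m\<in>UNIV. (\<Sum>j\<in>UNIV. b m j * f j) * (\<Sum>a\<in>UNIV. b m a * g a))" for f g :: "'n \<Rightarrow> real"
    proof -
      have "(\<Sum>j\<in>UNIV. f j * (\<Sum>a\<in>UNIV. P $ j $ a * g a))
          = (\<Sum>j\<in>UNIV. \<Sum>a\<in>UNIV. \<Sum>m\<in>UNIV. (b m j * f j) * (b m a * g a))"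
        by (simp add: b sum_distrib_left sum_distrib_right mult_ac)
      also have "\<dots> = (\<Sum>j\<in>UNIV. \<Sum>m\<in>UNIV. \<Sum>a\<in>UNIV. (b m j * f j) * (b m a * g a))"
        by (rule sum.cong[OF refl], rule sum.swap)
      also have "\<dots> = (\<Sum>m\<in>UNIV. \<Sum>j\<in>UNIV. \<Sum>a\<in>UNIV. (b m j * f j) * (b m a * g a))"
        by (rule sum.swap)
      finally show ?thesis by (simp add: sum_product)
    qed
    have pull: "(\<Sum>a\<in>UNIV. c a * (\<Sum>k\<in>UNIV. f k * g a k)) = (\<Sum>k\<in>UNIV. f k * (\<Sum>a\<in>UNIV. c a * g a k))"
      for c f :: "'n \<Rightarrow> real" and g
      by (simp add: sum_distrib_left mult_ac) (rule sum.swap)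
    \<comment> \<open>\<open>T1\<close> and \<open>T2\<close> have \<open>b\<close> applied to the
      first slot and to the first two. The sums are reordered below so that the next slot to be
      treated is summed innermost.\<close>
    define T1 where "T1 m k l = (\<Sum>j\<in>UNIV. b m j * T j k l)" for m k l
    define T2 where "T2 m m' l = (\<Sum>k\<in>UNIV. b m' k * T1 m k l)" for m m' l
    have T1: "(\<Sum>j\<in>UNIV. T j k l * (\<Sum>a\<in>UNIV. P $ j $ a * (\<Sum>b\<in>UNIV. P $ k $ b * (\<Sum>c\<in>UNIV. P $ l $ c * T a b c))))
      = (\<Sum>m\<in>UNIV. T1 m k l * (\<Sum>b\<in>UNIV. P $ k $ b * (\<Sum>c\<in>UNIV. P $ l $ c * T1 m b c)))" for k l
      unfolding gram T1_def by (simp only: pull[of "b _" "($) (P $ k)"] pull[of "b _" "($) (P $ l)"])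
    have T2: "(\<Sum>k\<in>UNIV. T1 m k l * (\<Sum>b\<in>UNIV. P $ k $ b * (\<Sum>c\<in>UNIV. P $ l $ c * T1 m b c)))
      = (\<Sum>m'\<in>UNIV. T2 m m' l * (\<Sum>c\<in>UNIV. P $ l $ c * T2 m m' c))" for m l
      unfolding gram T2_def by (simp only: pull[of "b _" "($) (P $ l)"])
    have T3: "(\<Sum>l\<in>UNIV. T2 m m' l * (\<Sum>c\<in>UNIV. P $ l $ c * T2 m m' c)) = (\<Sum>m''\<in>UNIV. (S m m' m'')\<^sup>2)" for m m'
    proof -
      have "(\<Sum>l\<in>UNIV. b m'' l * T2 m m' l) = S m m' m''" for m''
      proof -
        have "S m m' m'' = (\<Sum>j\<in>UNIV. b m j * (\<Sum>k\<in>UNIV. \<Sum>l\<in>UNIV. b m'' l * (b m' k * T j k l)))"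
          by (simp add: S_def sum_distrib_left mult_ac)
        also have "\<dots> = (\<Sum>j\<in>UNIV. b m j * (\<Sum>l\<in>UNIV. b m'' l * (\<Sum>k\<in>UNIV. b m' k * T j k l)))"
          by (subst sum.swap) (simp add: sum_distrib_left)
        also have "\<dots> = (\<Sum>l\<in>UNIV. b m'' l * (\<Sum>j\<in>UNIV. b m j * (\<Sum>k\<in>UNIV. b m' k * T j k l)))"
          by (rule pull)
        also have "\<dots> = (\<Sum>l\<in>UNIV. b m'' l * T2 m m' l)"
          unfolding T2_def T1_def by (intro sum.cong refl arg_cong2[of _ _ _ _ "(*)"] pull)
        finally show ?thesis ..
      qed
      then show ?thesis unfolding gram power2_eq_square by simp
    qed
    have "?lhs = (\<Sum>j\<in>UNIV. \<Sum>k\<in>UNIV. \<Sum>l\<in>UNIV. T j k l *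
      (\<Sum>a\<in>UNIV. P $ j $ a * (\<Sum>b\<in>UNIV. P $ k $ b * (\<Sum>c\<in>UNIV. P $ l $ c * T a b c))))"
      by (simp add: sum_distrib_left mult_ac)
    also have "\<dots> = (\<Sum>k\<in>UNIV. \<Sum>j\<in>UNIV. \<Sum>l\<in>UNIV. T j k l *
      (\<Sum>a\<in>UNIV. P $ j $ a * (\<Sum>b\<in>UNIV. P $ k $ b * (\<Sum>c\<in>UNIV. P $ l $ c * T a b c))))"
      by (rule sum.swap)
    also have "\<dots> = (\<Sum>k\<in>UNIV. \<Sum>l\<in>UNIV. \<Sum>j\<in>UNIV. T j k l *
      (\<Sum>a\<in>UNIV. P $ j $ a * (\<Sum>b\<in>UNIV. P $ k $ b * (\<Sum>c\<in>UNIV. P $ l $ c * T a b c))))"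
      by (rule sum.cong[OF refl], rule sum.swap)
    also have "\<dots> = (\<Sum>k\<in>UNIV. \<Sum>l\<in>UNIV. \<Sum>m\<in>UNIV. T1 m k l *
      (\<Sum>b\<in>UNIV. P $ k $ b * (\<Sum>c\<in>UNIV. P $ l $ c * T1 m b c)))"
      by (simp only: T1)
    also have "\<dots> = (\<Sum>l\<in>UNIV. \<Sum>k\<in>UNIV. \<Sum>m\<in>UNIV. T1 m k l *
      (\<Sum>b\<in>UNIV. P $ k $ b * (\<Sum>c\<in>UNIV. P $ l $ c * T1 m b c)))"
      by (rule sum.swap)
    also have "\<dots> = (\<Sum>l\<in>UNIV. \<Sum>m\<in>UNIV. \<Sum>k\<in>UNIV. T1 m k l *
      (\<Sum>b\<in>UNIV. P $ k $ b * (\<Sum>c\<in>UNIV. P $ l $ c * T1 m b c)))"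
      by (rule sum.cong[OF refl], rule sum.swap)
    also have "\<dots> = (\<Sum>l\<in>UNIV. \<Sum>m\<in>UNIV. \<Sum>m'\<in>UNIV. T2 m m' l * (\<Sum>c\<in>UNIV. P $ l $ c * T2 m m' c))"
      by (simp only: T2)
    also have "\<dots> = (\<Sum>m\<in>UNIV. \<Sum>l\<in>UNIV. \<Sum>m'\<in>UNIV. T2 m m' l * (\<Sum>c\<in>UNIV. P $ l $ c * T2 m m' c))"
      by (rule sum.swap)
    also have "\<dots> = (\<Sum>m\<in>UNIV. \<Sum>m'\<in>UNIV. \<Sum>l\<in>UNIV. T2 m m' l * (\<Sum>c\<in>UNIV. P $ l $ c * T2 m m' c))"
      by (rule sum.cong[OF refl], rule sum.swap)
    also have "\<dots> = (\<Sum>m\<in>UNIV. \<Sum>m'\<in>UNIV. \<Sum>m''\<in>UNIV. (S m m' m'')\<^sup>2)"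
      by (simp only: T3)
    finally show ?thesis .
  qed
  then have "(\<Sum>m\<in>UNIV. \<Sum>m'\<in>UNIV. \<Sum>m''\<in>UNIV. (S m m' m'')\<^sup>2) = 0" using zero by simp
  then have "S m m' m'' = 0" for m m' m''
    by (simp add: sum_nonneg_eq_0_iff sum_nonneg)
  \<comment> \<open>Injectivity of \<open>b\<close> now removes one slot at a time.\<close>
  then have "(\<Sum>k\<in>UNIV. b m' k * (\<Sum>l\<in>UNIV. b m'' l * T j k l)) = 0" for m' m'' j
    by (intro inj[of "\<lambda>j. \<Sum>k\<in>UNIV. b m' k * (\<Sum>l\<in>UNIV. b m'' l * T j k l)"]) (simp add: S_def)
  then have "(\<Sum>l\<in>UNIV. b m'' l * T j k l) = 0" for m'' j k
    by (intro inj[of "\<lambda>k. \<Sum>l\<in>UNIV. b m'' l * T j k l"]) simp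
  then show ?thesis by (intro inj[of "\<lambda>l. T j k l"]) simp
qed

text \<open>Multiplied by the entry \<open>h $ a $ a\<close>, the form becomes a square plus
  \<open>det h\<close> times a square, so it has the sign of this entry. This supplies definiteness
  for surfaces, where only positive curvature is assumed.\<close>

lemma definite_of_det_pos:
  fixes h :: "real^'n::finite^'n"
  assumes "CARD('n) = 2" "det h > 0" "\<And>i j. h $ i $ j = h $ j $ i"
  shows "(\<forall>v. v \<noteq> 0 \<longrightarrow> v \<bullet> (h *v v) > 0) \<or> (\<forall>v. v \<noteq> 0 \<longrightarrow> v \<bullet> (h *v v) < 0)"
proof -
  obtain a b :: 'n where ab: "UNIV = {a, b}" "a \<noteq> b"
    using assms(1) by (auto simp: card_2_iff)
  have f: "finite {b}" "a \<notin> {b}" using ab by auto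
  define d where "d = h $ a $ a * h $ b $ b - h $ a $ b * h $ a $ b"
  have "det h = d"
    unfolding det_def ab(1) sum_over_permutations_insert[OF f] permutes_sing
    using ab(2) by (simp add: sign_swap_id sign_id swap_id_eq d_def assms(3)[of b a])
  then have d: "d > 0" using assms(2) by simp
  have q: "v \<bullet> (h *v v) = h $ a $ a * (v $ a)\<^sup>2 + 2 * h $ a $ b * v $ a * v $ b + h $ b $ b * (v $ b)\<^sup>2" for v
    using ab(2) by (simp add: inner_vec_def matrix_vector_mult_def ab(1) assms(3)[of b a] power2_eq_square algebra_simps)
  have "h $ a $ a * (v \<bullet> (h *v v)) = (h $ a $ a * v $ a + h $ a $ b * v $ b)\<^sup>2 + d * (v $ b)\<^sup>2" for v
    unfolding q d_def by (simp add: power2_eq_square algebra_simps)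
  moreover have "(h $ a $ a * v $ a + h $ a $ b * v $ b)\<^sup>2 + d * (v $ b)\<^sup>2 > 0" if "v \<noteq> 0" for v
  proof (cases "v $ b = 0")
    case True
    then have "v $ a \<noteq> 0" using that ab(1) by (metis UNIV_I insertE singletonD vec_eq_iff zero_index)
    moreover have "h $ a $ a \<noteq> 0" using d by (auto simp: d_def not_less[symmetric])
    ultimately show ?thesis using True by simp
  next
    case False
    then show ?thesis using d by (simp add: add_nonneg_pos)
  qed
  ultimately have *: "h $ a $ a * (v \<bullet> (h *v v)) > 0" if "v \<noteq> 0" for v using that by simp
  show ?thesis
  proof (cases "h $ a $ a > 0")
    case True
    then show ?thesis using * by (simp add: zero_less_mult_iff)
  next
    case False
    then show ?thesis using * by (simp add: zero_less_mult_iff)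
  qed
qed

section \<open>Relative normalizations in local coordinates\<close>

lemma differentiable_vec:
  fixes f :: "'a::real_normed_vector \<Rightarrow> 'b::euclidean_space^'m::finite"
  assumes "\<And>i. (\<lambda>v. f v $ i) differentiable (at u)"
  shows "f differentiable (at u)"
  unfolding differentiable_componentwise_within[of f u UNIV]
proof
  fix b :: "'b^'m" assume "b \<in> Basis"
  then obtain i c where b: "b = axis i c" by (auto simp: Basis_vec_def)
  have "(\<lambda>v. f v $ i \<bullet> c) differentiable (at u)"
    using assms[of i] bounded_linear.has_derivative[OF bounded_linear_inner_left]
    by (fastforce simp: differentiable_def)
  then show "(\<lambda>v. f v \<bullet> b) differentiable (at u)"
    by (simp add: b inner_axis)
qed

lemma differentiable_nth:
  fixes f :: "'a::real_normed_vector \<Rightarrow> real^'m::finite"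
  assumes "f differentiable (at u)"
  shows "(\<lambda>v. f v $ i) differentiable (at u)"
  using assms bounded_linear.has_derivative[OF bounded_linear_vec_nth] by (fastforce simp: differentiable_def)

lemma sum_UNIV_option: "(\<Sum>a\<in>UNIV. f a) = (\<Sum>i\<in>(UNIV :: 'n::finite set). f (Some i)) + (f None :: 'b::comm_monoid_add)"
  by (simp add: UNIV_option_conv sum.reindex add.commute)

lemma frame_None: "frame F u w $ None = w"
  and frame_Some: "frame F u w $ Some i = pd i F u"
  by (simp_all add: frame_def)

lemma frame_vector_mult:
  "(frame F u w *v z) $ None = w \<bullet> z" "(frame F u w *v z) $ Some i = pd i F u \<bullet> z"
  by (simp_all add: frame_def matrix_vector_mult_def inner_vec_def)

text \<open>One chart with the least regularity that \<open>r\<close> and \<open>s\<close> admit;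
  \<open>chart_patch\<close> reduces every other case to it.\<close>

locale relative_patch =
  fixes F Y :: "real^'n::finite \<Rightarrow> real^('n option)" and S :: "(real^'n) set"
  assumes open_S: "open S"
    and C3_F: "Ck_on 3 F S"
    and C1_Y: "Ck_on 1 Y S"
    and indep: "\<And>u a b. u \<in> S \<Longrightarrow> (\<Sum>i\<in>UNIV. a i *\<^sub>R pd i F u) + b *\<^sub>R Y u = 0 \<Longrightarrow> (\<forall>i. a i = 0) \<and> b = 0"
    and tangential: "\<And>u i. u \<in> S \<Longrightarrow> pd i Y u \<in> span (range (\<lambda>j. pd j F u))"
    and support_pos: "\<And>u. u \<in> S \<Longrightarrow> support_function F Y u > 0"
begin

abbreviation E where "E u \<equiv> frame F u (Y u)"
abbreviation X where "X \<equiv> covector F Y"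
abbreviation G where "G \<equiv> rel_metric F Y"

text \<open>Together with \<open>X\<close> these vectors form the basis dual to the frame
  \<open>F\<^sub>i\<close>, \<open>Y\<close>. They are read off an inverse matrix because
  differentiability of its entries follows from that of the frame.\<close>

definition dual :: "'n \<Rightarrow> real^'n \<Rightarrow> real^('n option)" where
  "dual m u = column (Some m) (matrix_inv (E u))"

lemma F_diff:
  assumes "u \<in> S"
  shows "F differentiable (at u)" "pd i F differentiable (at u)" "pd j (pd i F) differentiable (at u)"
  using C3_F assms by (auto simp: eval_nat_numeral)

lemma F3_cont: "continuous_on S (pd k (pd j (pd i F)))"
  using C3_F by (auto simp: eval_nat_numeral)

lemma Y_diff: "u \<in> S \<Longrightarrow> Y differentiable (at u)"
  using C1_Y by auto

lemma F2_sym: "u \<in> S \<Longrightarrow> pd j (pd i F) u = pd i (pd j F) u"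
  by (rule pd_commute[OF open_S]) (auto intro: F_diff)

lemma F3_sym: "u \<in> S \<Longrightarrow> pd l (pd j (pd i F)) u = pd j (pd l (pd i F)) u"
  by (rule pd_commute[OF open_S]) (auto intro: F_diff)

lemma F3_sym': "u \<in> S \<Longrightarrow> pd l (pd j (pd i F)) u = pd l (pd i (pd j F)) u"
  by (rule pd_transform[OF open_S]) (auto intro: F2_sym)

lemma tangential_inner: "u \<in> S \<Longrightarrow> (\<And>j. w \<bullet> pd j F u = 0) \<Longrightarrow> w \<bullet> pd i Y u = 0"
  using orthogonal_to_span[of "pd i Y u" "range (\<lambda>j. pd j F u)" w] tangential[of u i]
  by (auto simp: orthogonal_def)

lemma det_E: assumes "u \<in> S" shows "det (E u) \<noteq> 0"
proof -
  have "inj ((*v) (transpose (E u)))"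
  proof (rule linear_injective_0[THEN iffD2, OF matrix_vector_mul_linear], intro allI impI)
    fix x :: "real^('n option)" assume x: "transpose (E u) *v x = 0"
    have "transpose (E u) *v x = (\<Sum>a\<in>UNIV. x $ a *\<^sub>R E u $ a)"
      by (simp only: matrix_mult_sum scalar_mult_eq_scaleR column_transpose row_def vec_lambda_eta)
    also have "\<dots> = (\<Sum>i\<in>UNIV. x $ Some i *\<^sub>R pd i F u) + x $ None *\<^sub>R Y u"
      by (simp only: sum_UNIV_option frame_None frame_Some)
    finally have "(\<forall>i. x $ Some i = 0) \<and> x $ None = 0"
      by (rule indep[OF assms, OF trans[OF sym x]])
    then have "x $ a = 0" for a by (cases a) auto
    then show "x = 0" by (simp add: vec_eq_iff)
  qed
  then have "det (transpose (E u)) \<noteq> 0"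
    using det_nz_iff_inj[OF matrix_vector_mul_linear, of "transpose (E u)"]
    by (simp only: matrix_of_matrix_vector_mul)
  then show ?thesis by simp
qed

lemma E_inv: 
  assumes "u \<in> S"
  shows "(E u *v column a (matrix_inv (E u))) $ b = of_bool (a = b)"
proof -
  have "E u *v column a (matrix_inv (E u)) = column a (mat 1)"
    unfolding matrix_inv_mult(1)[OF det_E[OF assms], symmetric]
    by (simp add: vec_eq_iff matrix_vector_mult_def matrix_matrix_mult_def column_def)
  then show ?thesis by (simp add: column_def mat_def)
qed

lemma dual_F: "u \<in> S \<Longrightarrow> dual m u \<bullet> pd i F u = of_bool (m = i)"
  and dual_Y: "u \<in> S \<Longrightarrow> dual m u \<bullet> Y u = 0"
  using E_inv[of u "Some m" "Some i"] E_inv[of u "Some m" None]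
  by (simp_all add: dual_def frame_vector_mult inner_commute)

lemma frame_ext:
  assumes "u \<in> S" "\<And>i. w \<bullet> pd i F u = 0" "w \<bullet> Y u = 0"
  shows "w = 0"
proof -
  have "E u *v w = 0"
    using assms(2,3) by (simp add: vec_eq_iff split_option_all frame_vector_mult inner_commute)
  then have "(matrix_inv (E u) ** E u) *v w = 0"
    by (simp add: matrix_vector_mul_assoc[symmetric])
  then show ?thesis using matrix_inv_mult(2)[OF det_E[OF assms(1)]] by simp
qed

lemma frame_eqI:
  assumes "u \<in> S" "\<And>i. w \<bullet> pd i F u = z \<bullet> pd i F u" "w \<bullet> Y u = z \<bullet> Y u"
  shows "w = z"
  using frame_ext[OF assms(1), of "w - z"] assms(2,3) by (simp add: inner_diff_left)

text \<open>All vectors orthogonal to the tangent space are multiples of one column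
  \<open>X0\<close> of the inverse frame, so the description in \<open>unit_normal\<close> has to be
  resolved on this line only. As \<open>X0\<close> pairs to 1 with \<open>Y u\<close>, the factor is
  the support function.\<close>

lemma covector_eq_column:
  assumes "u \<in> S"
  shows "X u = column None (matrix_inv (E u))"
    and "norm (unit_normal F u) = 1"
    and "unit_normal F u = support_function F Y u *\<^sub>R X u"
    and "det (frame F u (unit_normal F u)) * support_function F Y u = det (E u)"
proof -
  let ?q = "support_function F Y u" and ?\<nu> = "unit_normal F u"
  define X0 where "X0 = column None (matrix_inv (E u))"
  have X0: "X0 \<bullet> pd i F u = 0" "X0 \<bullet> Y u = 1" for i
    using E_inv[OF assms, of None "Some i"] E_inv[OF assms, of None None]
    by (simp_all add: X0_def frame_vector_mult inner_commute)
  define D where "D = det (E u)"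
  have "D \<noteq> 0" using det_E[OF assms] by (simp add: D_def)
  \<comment> \<open>Multiplied by the inverse of \<open>E u\<close>, the frame with \<open>w\<close>
    in place of \<open>Y u\<close> differs from the identity matrix in the row \<open>None\<close>
    only, whose diagonal entry is \<open>X0 \<bullet> w\<close>.\<close>
  have det_frame: "det (frame F u w) = (X0 \<bullet> w) * D" for w
  proof -
    let ?M = "frame F u w ** matrix_inv (E u)"
    have M: "?M $ a $ b = (frame F u w *v column b (matrix_inv (E u))) $ a" for a b
      by (simp add: matrix_matrix_mult_def matrix_vector_mult_def column_def)
    have "det ?M = det (transpose ?M)" by simp
    also have "\<dots> = transpose ?M $ None $ None * det (\<chi> i j. transpose ?M $ Some i $ Some j)"
      by (rule det_option) (use X0(1) in \<open>simp add: transpose_def M frame_vector_mult X0_def inner_commute\<close>)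
    also have "(\<chi> i j. transpose ?M $ Some i $ Some j) = mat 1"
      using dual_F[OF assms] by (simp add: vec_eq_iff transpose_def M frame_vector_mult mat_def dual_def inner_commute)
    also have "transpose ?M $ None $ None = X0 \<bullet> w"
      by (simp add: transpose_def M frame_vector_mult X0_def inner_commute)
    finally have "det (frame F u w) * det (matrix_inv (E u)) = X0 \<bullet> w" by (simp add: det_mul)
    moreover have "det (matrix_inv (E u)) * D = 1"
      using matrix_inv_mult(2)[OF det_E[OF assms]] unfolding D_def by (metis det_I det_mul)
    ultimately show ?thesis
      by (metis (no_types) mult.assoc mult.right_neutral)
  qed
  have "X0 \<noteq> 0" using X0(2) by auto
  \<comment> \<open>The length condition fixes the absolute value of the factor and the orientation
    condition its sign, since \<open>frame F u (c *\<^sub>R X0)\<close> has determinant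
    \<open>c * (norm X0)\<^sup>2 * D\<close>.\<close>
  define c where "c = sgn (D) / norm X0"
  have "c * (norm X0)\<^sup>2 * D = \<bar>D\<bar> * norm X0"
    
  proof -
    have "c * (norm X0)\<^sup>2 = sgn (D) * norm X0"
      using \<open>X0 \<noteq> 0\<close> unfolding c_def power2_eq_square by simp
    then show ?thesis unfolding abs_sgn[of "D"] by simp
  qed
  then have c1: "c * (norm X0)\<^sup>2 * D > 0"
    using \<open>D \<noteq> 0\<close> \<open>X0 \<noteq> 0\<close> by (metis mult_pos_pos zero_less_abs_iff zero_less_norm_iff)
  have "\<bar>sgn (D)\<bar> = 1" using \<open>D \<noteq> 0\<close> by (simp add: abs_sgn_eq)
  then have c2: "\<bar>c\<bar> * norm X0 = 1" using \<open>X0 \<noteq> 0\<close> by (simp add: c_def)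
  have "\<exists>!z. norm z = 1 \<and> (\<forall>i. z \<bullet> pd i F u = 0) \<and> det (frame F u z) > 0"
  proof (rule ex1I[of _ "c *\<^sub>R X0"])
    show "norm (c *\<^sub>R X0) = 1 \<and> (\<forall>i. c *\<^sub>R X0 \<bullet> pd i F u = 0) \<and> det (frame F u (c *\<^sub>R X0)) > 0"
    proof (intro conjI allI)
      show "norm (c *\<^sub>R X0) = 1" using c2 by simp
      show "c *\<^sub>R X0 \<bullet> pd i F u = 0" for i using X0 by simp
      show "det (frame F u (c *\<^sub>R X0)) > 0"
        using c1 unfolding det_frame inner_scaleR_right power2_norm_eq_inner .
    qed
    fix z assume z: "norm z = 1 \<and> (\<forall>i. z \<bullet> pd i F u = 0) \<and> det (frame F u z) > 0"
    have z': "z = (z \<bullet> Y u) *\<^sub>R X0"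
    proof (rule frame_eqI[OF assms])
      show "z \<bullet> pd i F u = (z \<bullet> Y u) *\<^sub>R X0 \<bullet> pd i F u" for i
        using z X0(1)[of i] by simp
      show "z \<bullet> Y u = (z \<bullet> Y u) *\<^sub>R X0 \<bullet> Y u"
        unfolding inner_scaleR_left X0(2) by simp
    qed
    define d where "d = z \<bullet> Y u"
    have d: "z = d *\<^sub>R X0" using z' by (simp add: d_def)
    have d': "d * (norm X0)\<^sup>2 * D > 0" "\<bar>d\<bar> * norm X0 = 1"
      using z unfolding d det_frame inner_scaleR_right power2_norm_eq_inner norm_scaleR by simp_all
    have "(\<bar>d\<bar> - \<bar>c\<bar>) * norm X0 = 0" using d'(2) c2 by (simp add: left_diff_distrib)
    then have "\<bar>d\<bar> = \<bar>c\<bar>" using \<open>X0 \<noteq> 0\<close> by simp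
    moreover have "d \<noteq> - c" using d'(1) c1 by auto
    ultimately have "d = c" by linarith
    then show "z = c *\<^sub>R X0" using d by simp
  qed
  from theI'[OF this, folded unit_normal_def]
  have nu: "norm ?\<nu> = 1" "\<And>i. ?\<nu> \<bullet> pd i F u = 0" by auto
  have nX: "?\<nu> = ?q *\<^sub>R X0"
  proof (rule frame_eqI[OF assms])
    show "?\<nu> \<bullet> pd i F u = ?q *\<^sub>R X0 \<bullet> pd i F u" for i
      using nu(2) X0(1)[of i] by simp
    show "?\<nu> \<bullet> Y u = ?q *\<^sub>R X0 \<bullet> Y u"
      unfolding inner_scaleR_left X0(2) by (simp add: support_function_def)
  qed
  show XX: "X u = column None (matrix_inv (E u))"
    using nX support_pos[OF assms] by (simp add: covector_def X0_def)
  show "norm ?\<nu> = 1" by (rule nu)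
  show "?\<nu> = ?q *\<^sub>R X u" using nX XX by (simp add: X0_def)
  have "det (frame F u ?\<nu>) * ?q = (?\<nu> \<bullet> ?\<nu>) * D"
    using arg_cong[OF nX, of "\<lambda>z. z \<bullet> ?\<nu>"] by (simp add: det_frame)
  then show "det (frame F u ?\<nu>) * ?q = det (E u)"
    using nu(1) by (simp add: norm_eq_1 D_def)
qed

lemma X_F: "u \<in> S \<Longrightarrow> X u \<bullet> pd i F u = 0"
  and X_Y: "u \<in> S \<Longrightarrow> X u \<bullet> Y u = 1"
  using E_inv[of u None "Some i"] E_inv[of u None None]
  by (simp_all add: covector_eq_column frame_vector_mult inner_commute)

text \<open>The difference of both sides is orthogonal to all columns of the invertible matrix
  \<open>matrix_inv (E u)\<close>.\<close>

lemma frame_expansion: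
  assumes "u \<in> S"
  shows "w = (\<Sum>m\<in>UNIV. (dual m u \<bullet> w) *\<^sub>R pd m F u) + (X u \<bullet> w) *\<^sub>R Y u"
proof -
  define d where "d = w - ((\<Sum>m\<in>UNIV. (dual m u \<bullet> w) *\<^sub>R pd m F u) + (X u \<bullet> w) *\<^sub>R Y u)"
  have "dual m u \<bullet> d = 0" "X u \<bullet> d = 0" for m
    using assms by (simp_all add: d_def inner_diff_right inner_add_right inner_sum_right dual_F dual_Y X_F X_Y)
  then have "(transpose (matrix_inv (E u)) *v d) $ a = 0" for a
    using assms by (cases a) (simp_all add: matrix_vector_mult_def transpose_def dual_def covector_eq_column column_def inner_vec_def)
  then have "transpose (matrix_inv (E u)) *v d = 0" by (simp add: vec_eq_iff)
  then have "transpose (E u) *v (transpose (matrix_inv (E u)) *v d) = 0" by simp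
  then have "d = 0"
    using matrix_inv_mult(2)[OF det_E[OF assms]]
    by (simp only: matrix_vector_mul_assoc matrix_transpose_mul[symmetric] transpose_mat matrix_vector_mul_lid)
  then show ?thesis by (simp add: d_def)
qed

lemma E_diff: assumes "u \<in> S" shows "(\<lambda>v. E v $ a $ b) differentiable (at u)"
  by (cases a) (simp_all add: frame_None frame_Some differentiable_nth F_diff Y_diff assms)

lemma column_diff: 
  assumes "u \<in> S" shows "(\<lambda>v. column a (matrix_inv (E v))) differentiable (at u)"
  by (rule differentiable_vec)
    (simp add: column_def differentiable_matrix_inv[OF open_S assms det_E E_diff[OF assms]])

lemma dual_diff: "u \<in> S \<Longrightarrow> dual m differentiable (at u)"
  using column_diff[of u "Some m"] by (simp add: dual_def[abs_def])

lemma X_diff: assumes "u \<in> S" shows "X differentiable (at u)"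
  by (rule differentiable_transform_open[OF column_diff[OF assms] open_S assms])
    (rule covector_eq_column(1)[symmetric])

lemma G_nth: "G u $ i $ j = X u \<bullet> pd j (pd i F) u"
  by (simp add: rel_metric_def)

lemma G_sym: "u \<in> S \<Longrightarrow> G u $ i $ j = G u $ j $ i"
  by (simp add: G_nth F2_sym)

lemma G_diff: "u \<in> S \<Longrightarrow> (\<lambda>v. G v $ i $ j) differentiable (at u)"
  unfolding G_nth by (intro pd_inner X_diff F_diff)

lemma pd_G_sym: "u \<in> S \<Longrightarrow> pd l (\<lambda>v. G v $ i $ j) u = pd l (\<lambda>v. G v $ j $ i) u"
  by (rule pd_transform[OF open_S]) (auto intro: G_sym)

lemma pd_G: "u \<in> S \<Longrightarrow> pd l (\<lambda>v. G v $ i $ j) u = X u \<bullet> pd l (pd j (pd i F)) u + pd l X u \<bullet> pd j (pd i F) u"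
  unfolding G_nth by (intro pd_inner X_diff F_diff)

text \<open>Differentiate \<open>X \<bullet> F\<^sub>j = 0\<close>.\<close>

lemma pd_X_F: assumes "u \<in> S" shows "pd l X u \<bullet> pd j F u = - G u $ j $ l"
  using pd_inner(1)[OF X_diff F_diff(2), OF assms assms, of l j] 
    pd_zero_on[OF open_S assms, of "\<lambda>v. X v \<bullet> pd j F v" 0 l] X_F
  by (simp add: G_nth)

text \<open>Differentiate \<open>X \<bullet> Y = 1\<close>; the derivatives of \<open>Y\<close> are
  tangential, so \<open>X\<close> annihilates them.\<close>

lemma pd_X_Y: assumes "u \<in> S" shows "pd l X u \<bullet> Y u = 0"
  using pd_inner(1)[OF X_diff Y_diff, OF assms assms, of l] 
    pd_zero_on[OF open_S assms, of "\<lambda>v. X v \<bullet> Y v" 1 l] X_Y tangential_inner[OF assms X_F[OF assms]]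
  by simp

lemma pd_X: assumes "u \<in> S" shows "pd l X u = - (\<Sum>j\<in>UNIV. G u $ l $ j *\<^sub>R dual j u)"
  by (rule frame_eqI[OF assms])
    (simp_all add: assms pd_X_F pd_X_Y inner_sum_left dual_F dual_Y G_sym[OF assms, of l] )

text \<open>The formula \<open>pd_X\<close> involves only \<open>G\<close> and the dual frame, which
  contain \<open>Y\<close> but none of its derivatives. Hence \<open>X\<close> has second
  derivatives although \<open>Y\<close> need not have them.\<close>

lemma pd_X_diff: assumes "u \<in> S" shows "pd l X differentiable (at u)"
proof -
  have "(\<lambda>v. - (\<Sum>j\<in>UNIV. G v $ l $ j *\<^sub>R dual j v)) differentiable (at u)"
    by (intro differentiable_minus differentiable_sum pd_scaleR(2) G_diff dual_diff assms ballI) auto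
  from differentiable_transform_open[OF this open_S assms pd_X[symmetric]]
  show ?thesis by simp
qed

lemma pd_G_cont: "continuous_on S (pd l (\<lambda>v. G v $ i $ j))"
proof -
  have "continuous_on S (\<lambda>u. X u \<bullet> pd l (pd j (pd i F)) u + pd l X u \<bullet> pd j (pd i F) u)"
    by (intro continuous_intros F3_cont differentiable_imp_continuous_on differentiable_at_imp_differentiable_on)
      (auto intro: X_diff pd_X_diff F_diff)
  then show ?thesis by (simp add: pd_G cong: continuous_on_cong)
qed

end

section \<open>Levi-Civita connection of the relative metric and Darboux tensor\<close>

locale nondegenerate_patch = relative_patch F Y S
  for F Y :: "real^'n::finite \<Rightarrow> real^('n option)" and S +
  assumes det_G: "\<And>u. u \<in> S \<Longrightarrow> det (G u) \<noteq> 0"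
begin

lemma rel_metric_inv_G:
  assumes "u \<in> S"
  shows "(\<Sum>m\<in>UNIV. rel_metric_inv F Y u $ m $ p * G u $ m $ l) = of_bool (p = l)"
proof -
  have "(G u ** rel_metric_inv F Y u) $ l $ p = of_bool (p = l)"
    using matrix_inv_mult(1)[OF det_G[OF assms]] by (simp add: rel_metric_inv_def mat_def)
  then show ?thesis
    by (simp add: matrix_matrix_mult_def G_sym[OF assms, of l] mult.commute)
qed

lemma christoffel_lower:
  assumes "u \<in> S"
  shows "(\<Sum>m\<in>UNIV. christoffel F Y m i j u * G u $ m $ l) =
    (1/2) * (pd i (\<lambda>v. G v $ j $ l) u + pd j (\<lambda>v. G v $ i $ l) u - pd l (\<lambda>v. G v $ i $ j) u)"
proof -
  let ?g = "\<lambda>l. pd i (\<lambda>v. G v $ j $ l) u + pd j (\<lambda>v. G v $ i $ l) u - pd l (\<lambda>v. G v $ i $ j) u"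
  define h where "h p = (1/2) * ?g p" for p
  have "(\<Sum>m\<in>UNIV. christoffel F Y m i j u * G u $ m $ l)
      = (\<Sum>m\<in>UNIV. \<Sum>p\<in>UNIV. h p * (rel_metric_inv F Y u $ m $ p * G u $ m $ l))"
    unfolding christoffel_def h_def sum_distrib_left sum_distrib_right by (simp add: mult_ac)
  also have "\<dots> = (\<Sum>p\<in>UNIV. h p * (\<Sum>m\<in>UNIV. rel_metric_inv F Y u $ m $ p * G u $ m $ l))"
    by (subst sum.swap) (simp add: sum_distrib_left)
  also have "\<dots> = h l" by (simp add: rel_metric_inv_G[OF assms])
  finally show ?thesis by (simp add: h_def)
qed

text \<open>The symbols contain first derivatives of \<open>G\<close>, thus third derivatives of
  \<open>F\<close>, and these are merely continuous.\<close>

lemma christoffel_cont: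
  assumes "u \<in> S"
  shows "continuous (at u) (christoffel F Y m i j)"
proof -
  have "continuous_on S (\<lambda>v. matrix_inv (G v) $ m $ l)" for m l
    by (intro differentiable_imp_continuous_on differentiable_at_imp_differentiable_on
        differentiable_matrix_inv[OF open_S] det_G G_diff)
  then have "continuous_on S (christoffel F Y m i j)"
    unfolding christoffel_def[abs_def] rel_metric_inv_def
    by (intro continuous_on_sum continuous_on_mult continuous_on_add continuous_on_diff
        continuous_on_const pd_G_cont)
  then show ?thesis using assms open_S by (simp add: continuous_on_eq_continuous_at)
qed

lemma darboux_eq:
  assumes "u \<in> S"
  shows "darboux F Y j k l u = X u \<bullet> pd l (pd k (pd j F)) u
    - (1/2) * (pd j (\<lambda>v. G v $ k $ l) u + pd k (\<lambda>v. G v $ j $ l) u + pd l (\<lambda>v. G v $ j $ k) u)"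
proof -
  have at_u: "X u \<bullet> cov_deriv2 F Y j k u = G u $ j $ k" for j k
    using assms by (simp add: cov_deriv2_def inner_diff_right inner_sum_right X_F G_nth)
  let ?g = "\<lambda>m v. X u \<bullet> pd m F v"
  have g: "?g m differentiable (at u)" "pd l (?g m) u = G u $ m $ l" "?g m u = 0" for m
    using pd_bounded_linear[OF bounded_linear_inner_right[of "X u"] F_diff(2)[OF assms, of m]]
    by (simp_all add: G_nth X_F assms)
  note cg = pd_mult_vanishing[OF christoffel_cont[OF assms] g(1) g(3)]
  note F2 = pd_bounded_linear[OF bounded_linear_inner_right[of "X u"] F_diff(3)[OF assms, of k j]]
  have "pd l (\<lambda>v. X u \<bullet> cov_deriv2 F Y j k v) u
      = pd l (\<lambda>v. X u \<bullet> pd k (pd j F) v - (\<Sum>m\<in>UNIV. christoffel F Y m k j v * ?g m v)) u"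
    by (simp add: cov_deriv2_def inner_diff_right inner_sum_right)
  also have "\<dots> = X u \<bullet> pd l (pd k (pd j F)) u - (\<Sum>m\<in>UNIV. christoffel F Y m k j u * G u $ m $ l)"
    using F2 cg g(2) by (simp add: pd_diff pd_sum differentiable_sum_UNIV)
  also have "\<dots> = X u \<bullet> pd l (pd k (pd j F)) u
      - (1/2) * (pd k (\<lambda>v. G v $ j $ l) u + pd j (\<lambda>v. G v $ k $ l) u - pd l (\<lambda>v. G v $ j $ k) u)"
    by (simp add: christoffel_lower[OF assms] pd_G_sym[OF assms, of l k j])
  finally have t1: "pd l (\<lambda>v. X u \<bullet> cov_deriv2 F Y j k v) u = \<dots>" .
  have t2: "(\<Sum>m\<in>UNIV. christoffel F Y m l j u * (X u \<bullet> cov_deriv2 F Y m k u))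
      = (1/2) * (pd l (\<lambda>v. G v $ j $ k) u + pd j (\<lambda>v. G v $ k $ l) u - pd k (\<lambda>v. G v $ j $ l) u)"
    by (simp add: at_u christoffel_lower[OF assms] pd_G_sym[OF assms, of j l k] pd_G_sym[OF assms, of k l j])
  have "(\<Sum>m\<in>UNIV. christoffel F Y m l k u * (X u \<bullet> cov_deriv2 F Y j m u))
      = (\<Sum>m\<in>UNIV. christoffel F Y m l k u * G u $ m $ j)"
    by (simp only: at_u G_sym[OF assms, of j])
  also have "\<dots> = (1/2) * (pd l (\<lambda>v. G v $ j $ k) u + pd k (\<lambda>v. G v $ j $ l) u - pd j (\<lambda>v. G v $ k $ l) u)"
    by (simp add: christoffel_lower[OF assms] pd_G_sym[OF assms, of j l k] pd_G_sym[OF assms, of k l j]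
        pd_G_sym[OF assms, of l k j])
  finally show ?thesis
    unfolding darboux_def t1 t2 by (simp add: algebra_simps)
qed

end

section \<open>Proportional derivatives\<close>

lemma bounded_bilinear_matrix_vector_mult:
  "bounded_bilinear ((*v) :: real^'n::finite^'m::finite \<Rightarrow> real^'n \<Rightarrow> real^'m)"
  unfolding bilinear_conv_bounded_bilinear[symmetric] bilinear_def
proof (intro conjI allI)
  show "linear ((*v) A)" for A :: "real^'n^'m" by (rule matrix_vector_mul_linear)
  show "linear (\<lambda>A :: real^'n^'m. A *v x)" for x
    by (rule linearI) (simp_all only: matrix_vector_mult_add_rdistrib scaleR_matrix_vector_assoc)
qed

text \<open>Along a segment on which coordinate \<open>j\<close> is constant the derivative
  vanishes.\<close>

lemma slice_constant:
  fixes h :: "real^'n::finite \<Rightarrow> real"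
  assumes "\<And>y. y \<in> ball c e \<Longrightarrow> (h has_derivative (\<lambda>v. - (l y * v $ j))) (at y)"
    and "y \<in> ball c e" "z \<in> ball c e" "y $ j = z $ j"
  shows "h y = h z"
proof -
  define \<phi> where "\<phi> t = h (y + t *\<^sub>R (z - y))" for t :: real
  have "\<phi> 0 = \<phi> 1"
  proof (rule has_derivative_zero_unique[where s = "{0..1::real}" and f = \<phi> and x = 0 and y = 1])
    fix t :: real assume t: "t \<in> {0..1::real}"
    have "y + t *\<^sub>R (z - y) = (1 - t) *\<^sub>R y + t *\<^sub>R z" by (simp add: algebra_simps)
    then have in_ball: "y + t *\<^sub>R (z - y) \<in> ball c e"
      using convexD[OF convex_ball assms(2,3), of "1 - t" t] t by simp
    have "(\<phi> has_derivative (\<lambda>x. - (l (y + t *\<^sub>R (z - y)) * (x *\<^sub>R (z - y)) $ j))) (at t within {0..1})"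
      unfolding \<phi>_def
      by (rule has_derivative_compose[where f = "\<lambda>t. y + t *\<^sub>R (z - y)" and f' = "\<lambda>x. x *\<^sub>R (z - y)", OF _ assms(1)[OF in_ball]])
        (auto intro!: derivative_eq_intros)
    then show "(\<phi> has_derivative (\<lambda>x. 0)) (at t within {0..1})" using assms(4) by simp
  qed auto
  then show ?thesis by (simp add: \<phi>_def)
qed

text \<open>No regularity of \<open>l\<close> is available. But \<open>h\<close> is constant on
  slices, so near \<open>y\<close> it agrees with its translate by \<open>z - y\<close>; comparing
  the derivatives of both at \<open>y\<close> compares \<open>l y\<close> with
  \<open>l z\<close>.\<close>

lemma slice_constant_factor:
  fixes h :: "real^'n::finite \<Rightarrow> real"
  assumes deriv: "\<And>y. y \<in> ball c e \<Longrightarrow> (h has_derivative (\<lambda>v. - (l y * v $ j))) (at y)"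
    and y: "y \<in> ball c e" and z: "z \<in> ball c e" and "y $ j = z $ j"
  shows "l y = l z"
proof -
  \<comment> \<open>The points of the ball whose translates by \<open>z - y\<close> also lie in the
    ball.\<close>
  let ?S = "ball c e \<inter> ball (c - (z - y)) e"
  have S: "y \<in> ?S" using y z by (simp add: dist_norm algebra_simps)
  have inz: "w + (z - y) \<in> ball c e" if "w \<in> ?S" for w
    using that by (simp add: dist_norm algebra_simps)
  have "((\<lambda>w. h (w + (z - y))) has_derivative (\<lambda>v. - (l z * v $ j))) (at y)"
  proof -
    have "((\<lambda>w. w + (z - y)) has_derivative (\<lambda>v. v)) (at y)"
      by (auto intro!: derivative_eq_intros)
    from has_derivative_compose[OF this, of h "\<lambda>v. - (l z * v $ j)"] show ?thesis
      using deriv[OF z] by simp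
  qed
  then have "((\<lambda>w. h (w + (z - y)) - h w) has_derivative (\<lambda>v. - (l z * v $ j) - - (l y * v $ j))) (at y)"
    by (intro has_derivative_diff deriv y)
  from pd_at[OF this, of j] have "pd j (\<lambda>w. h (w + (z - y)) - h w) y = l y - l z" by (simp add: axis_def)
  moreover have "pd j (\<lambda>w. h (w + (z - y)) - h w) y = 0"
  proof (rule pd_zero_on[of ?S _ _ 0])
    fix w assume w: "w \<in> ?S"
    have "h (w + (z - y)) = h w"
      by (rule slice_constant[OF deriv inz[OF w]]) (use w assms(4) in auto)
    then show "h (w + (z - y)) - h w = 0" by simp
  qed (use S in auto)
  ultimately show ?thesis by simp
qed

text \<open>In the coordinates \<open>d j \<bullet> F\<close> the hypothesis \<open>par\<close> says
  that the differential of \<open>d j \<bullet> Y\<close> is \<open>- lam\<close> times the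
  differential of coordinate \<open>j\<close>. Then \<open>lam\<close> depends on coordinate
  \<open>j\<close> alone, for every \<open>j\<close>, and two different indices make it constant. No
  derivative of \<open>lam\<close> is formed.\<close>

lemma proportional_derivative_locally_constant:
  fixes F Y :: "real^'n::finite \<Rightarrow> 'b::euclidean_space"
  assumes "open S" "u \<in> S" "CARD('n) \<ge> 2"
    and F: "\<And>v. v \<in> S \<Longrightarrow> F differentiable (at v)" "\<And>i. continuous_on S (pd i F)"
    and Y: "\<And>v. v \<in> S \<Longrightarrow> Y differentiable (at v)"
    and par: "\<And>v i. v \<in> S \<Longrightarrow> pd i Y v = - lam v *\<^sub>R pd i F v"
    and d: "\<And>i j. d j \<bullet> pd i F u = of_bool (j = i)"
  obtains U where "open U" "u \<in> U" "U \<subseteq> S" "\<And>v. v \<in> U \<Longrightarrow> lam v = lam u"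
proof -
  define f where "f v = (\<chi> j. d j \<bullet> F v)" for v
  define f' where "f' v h = (\<chi> j. d j \<bullet> (\<Sum>i\<in>UNIV. h $ i *\<^sub>R pd i F v))" for v and h :: "real^'n"
  have f_deriv: "(f has_derivative f' v) (at v)" if "v \<in> S" for v
  proof -
    have "((\<lambda>v. d j \<bullet> F v) has_derivative (\<lambda>h. d j \<bullet> (\<Sum>i\<in>UNIV. h $ i *\<^sub>R pd i F v))) (at v)" for j
      by (rule has_derivative_inner_right[OF has_derivative_pd[OF F(1)[OF that]]])
    then show ?thesis
      unfolding f_def f'_def
      by (subst has_derivative_componentwise_within) (auto simp: Basis_vec_def inner_axis)
  qed
  have bl: "bounded_linear (f' v)" if "v \<in> S" for v
    using f_deriv[OF that] by (rule has_derivative_bounded_linear)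
  let ?f' = "\<lambda>v. Blinfun (f' v)"
  have f'_u: "f' u h = h" for h
    by (simp add: f'_def vec_eq_iff inner_sum_right d)
  have cont: "continuous_on S ?f'"
  proof (rule continuous_on_blinfun_componentwise)
    fix i :: "real^'n" assume "i \<in> Basis"
    have "continuous_on S (\<lambda>v. f' v i)"
      unfolding f'_def by (intro continuous_intros F(2))
    then show "continuous_on S (\<lambda>v. blinfun_apply (?f' v) i)"
      by (rule continuous_on_eq) (simp add: bounded_linear_Blinfun_apply bl)
  qed
  \<comment> \<open>By the choice of the \<open>d j\<close> the derivative of the new coordinates at
    \<open>u\<close> is the identity, so the inverse function theorem applies.\<close>
  have invf: "id_blinfun o\<^sub>L ?f' u = id_blinfun"
    by (rule blinfun_eqI) (simp add: bounded_linear_Blinfun_apply bl assms(2) f'_u)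
  obtain U' V g g' where U': "open U'" "U' \<subseteq> S" "u \<in> U'" and V: "open V" "f u \<in> V"
    and hom: "homeomorphism U' V f g" and g: "\<And>y. y \<in> V \<Longrightarrow> (g has_derivative (g' y)) (at y)"
    using inverse_function_theorem[OF assms(1) _ cont assms(2) invf, of f] f_deriv bl
    by (metis bounded_linear_Blinfun_apply)
  have gV: "g y \<in> S" "f (g y) = y" if "y \<in> V" for y
    using hom U'(2) that by (auto simp: homeomorphism_def)
  have f'g': "f' (g y) (g' y h) = h" if y: "y \<in> V" for y h
  proof -
    have "((\<lambda>y. f (g y)) has_derivative (\<lambda>h. f' (g y) (g' y h))) (at y)"
      by (rule has_derivative_compose[OF g[OF y] f_deriv[OF gV(1)[OF y]]])
    then have "((\<lambda>y. y) has_derivative (\<lambda>h. f' (g y) (g' y h))) (at y)"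
      by (rule has_derivative_transform_within_open[OF _ V(1) y]) (simp add: gV)
    then have "(\<lambda>h. f' (g y) (g' y h)) = (\<lambda>h. h)"
      by (rule has_derivative_unique) simp
    then show ?thesis by metis
  qed
  have h_deriv: "((\<lambda>y. d j \<bullet> Y (g y)) has_derivative (\<lambda>h. - (lam (g y) * h $ j))) (at y)" if y: "y \<in> V" for y j
  proof -
    have "((\<lambda>y. Y (g y)) has_derivative (\<lambda>h. \<Sum>i\<in>UNIV. g' y h $ i *\<^sub>R pd i Y (g y))) (at y)"
      by (rule has_derivative_compose[OF g[OF y] has_derivative_pd[OF Y[OF gV(1)[OF y]]]])
    then have "((\<lambda>y. d j \<bullet> Y (g y)) has_derivative (\<lambda>h. d j \<bullet> (\<Sum>i\<in>UNIV. g' y h $ i *\<^sub>R pd i Y (g y)))) (at y)"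
      by (rule has_derivative_inner_right)
    moreover have "d j \<bullet> (\<Sum>i\<in>UNIV. g' y h $ i *\<^sub>R pd i Y (g y)) = - (lam (g y) * h $ j)" for h
    proof -
      have "d j \<bullet> (\<Sum>i\<in>UNIV. g' y h $ i *\<^sub>R pd i Y (g y)) = - lam (g y) * (f' (g y) (g' y h)) $ j"
        by (simp add: par gV(1)[OF y] f'_def inner_sum_right sum_distrib_left mult_ac)
      then show ?thesis by (simp add: f'g'[OF y])
    qed
    ultimately show ?thesis by simp
  qed
  obtain e where "e > 0" and e: "ball (f u) e \<subseteq> V"
    using V open_contains_ball by blast
  obtain j k :: 'n where "j \<noteq> k"
    using assms(3) card_le_Suc0_iff_eq[of "UNIV :: 'n set"] by auto
  have slice: "lam (g y) = lam (g z)" if "y \<in> ball (f u) e" "z \<in> ball (f u) e" "y $ m = z $ m" for y z m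
    by (rule slice_constant_factor[of "f u" e "\<lambda>y. d m \<bullet> Y (g y)" "\<lambda>y. lam (g y)" m]) (use h_deriv e that in auto)
  have const: "lam (g y) = lam (g (f u))" if y: "y \<in> ball (f u) e" for y
  proof -
    \<comment> \<open>The corner between the two points: it shares coordinate \<open>j\<close> with
      \<open>y\<close> and coordinate \<open>k\<close> with \<open>f u\<close>.\<close>
    define w where "w = f u + (y - f u) $ j *\<^sub>R axis j 1"
    have "dist (f u) w = \<bar>(y - f u) $ j\<bar>" by (simp add: w_def dist_norm)
    also have "\<dots> \<le> norm (y - f u)" by (rule component_le_norm_cart)
    finally have w: "w \<in> ball (f u) e" using y by (simp add: dist_norm norm_minus_commute)
    have "lam (g y) = lam (g w)"
      by (rule slice[OF y w, of j]) (simp add: w_def)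
    also have "\<dots> = lam (g (f u))"
      by (rule slice[OF w, of _ k]) (use \<open>e > 0\<close> \<open>j \<noteq> k\<close> in \<open>auto simp: w_def axis_def\<close>)
    finally show ?thesis .
  qed
  have fcont: "continuous_on U' f" using hom by (simp add: homeomorphism_def)
  show ?thesis
  proof (rule that)
    show "open (U' \<inter> f -` ball (f u) e)"
      by (rule continuous_open_preimage[OF fcont U'(1) open_ball])
    show "lam v = lam u" if "v \<in> U' \<inter> f -` ball (f u) e" for v
      using const[of "f v"] that hom U'(3) by (auto simp: homeomorphism_def)
  qed (use U' \<open>e > 0\<close> in auto)
qed

section \<open>Vanishing Darboux tensor\<close>

locale flat_patch = nondegenerate_patch F Y S
  for F Y :: "real^'n::finite \<Rightarrow> real^('n option)" and S +
  assumes dim: "CARD('n) \<ge> 2"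
    and darboux_zero: "\<And>u j k l. u \<in> S \<Longrightarrow> darboux F Y j k l u = 0"
begin

text \<open>Each first derivative of \<open>G\<close> is the common term \<open>?c\<close> plus a
  product of a derivative of \<open>X\<close> and a second derivative of \<open>F\<close>; the
  vanishing Darboux tensor expresses \<open>?c\<close> by these products. The third derivatives of
  \<open>F\<close> disappear, so \<open>G\<close> turns out to be twice differentiable.\<close>

lemma pd_G_flat:
  assumes "u \<in> S"
  shows "pd l (\<lambda>v. G v $ j $ k) u = - (pd k X u \<bullet> pd l (pd j F) u) - pd j X u \<bullet> pd l (pd k F) u"
proof -
  let ?c = "X u \<bullet> pd l (pd k (pd j F)) u"
  have F3: "pd j (pd l (pd k F)) u = pd l (pd k (pd j F)) u" "pd k (pd l (pd j F)) u = pd l (pd k (pd j F)) u"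
    by (rule trans[OF F3_sym[OF assms, of j l k] F3_sym'[OF assms, of l j k]])
      (rule F3_sym[OF assms, of k l j])
  have "0 = ?c - (1/2) * (pd j (\<lambda>v. G v $ k $ l) u + pd k (\<lambda>v. G v $ j $ l) u + pd l (\<lambda>v. G v $ j $ k) u)"
    using darboux_eq[OF assms, of j k l] darboux_zero[OF assms, of j k l] by simp
  moreover have "pd j (\<lambda>v. G v $ k $ l) u = ?c + pd j X u \<bullet> pd l (pd k F) u"
    "pd k (\<lambda>v. G v $ j $ l) u = ?c + pd k X u \<bullet> pd l (pd j F) u"
    "pd l (\<lambda>v. G v $ j $ k) u = ?c + pd l X u \<bullet> pd k (pd j F) u"
    by (simp_all add: pd_G[OF assms] F3)
  ultimately show ?thesis by simp
qed

text \<open>Differentiate \<open>X\<^sub>k \<bullet> F\<^sub>j = - G\<^sub>j\<^sub>k\<close> and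
  insert \<open>pd_G_flat\<close>. The outcome means that \<open>F\<close> and the conormal field
  \<open>X\<close> induce the same connection coefficients.\<close>

lemma pd2_X_F:
  assumes "u \<in> S"
  shows "pd p (pd k X) u \<bullet> pd j F u = pd j X u \<bullet> pd p (pd k F) u"
proof -
  have "pd p (\<lambda>v. pd k X v \<bullet> pd j F v) u = pd p (\<lambda>v. - G v $ j $ k) u"
    by (rule pd_transform[OF open_S assms]) (rule pd_X_F)
  then have "pd k X u \<bullet> pd p (pd j F) u + pd p (pd k X) u \<bullet> pd j F u = - pd p (\<lambda>v. G v $ j $ k) u"
    by (simp add: pd_inner(1)[OF pd_X_diff[OF assms] F_diff(2)[OF assms]] pd_minus[OF G_diff[OF assms]])
  then show ?thesis using pd_G_flat[OF assms, of p j k] by simp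
qed

lemma pd2_X_Y:
  assumes "u \<in> S"
  shows "pd p (pd k X) u \<bullet> Y u = - (pd k X u \<bullet> pd p Y u)"
  using pd_inner(1)[OF pd_X_diff[OF assms] Y_diff[OF assms], of p k]
    pd_zero_on[OF open_S assms, of "\<lambda>v. pd k X v \<bullet> Y v" 0 p] pd_X_Y by simp

text \<open>The relative shape operator with its index lowered by \<open>G\<close>. The sign is that
  of the convention in which the operator is minus the derivative of \<open>Y\<close>, because
  \<open>X\<^sub>k \<bullet> F\<^sub>m = - G\<^sub>m\<^sub>k\<close>.\<close>

definition shape :: "'n \<Rightarrow> 'n \<Rightarrow> real^'n \<Rightarrow> real" where
  "shape k p u = pd k X u \<bullet> pd p Y u"

text \<open>Expanding \<open>F\<^sub>j\<^sub>l\<close> in the frame separates a tangential term,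
  quadratic in the connection coefficients, from the component along \<open>Y\<close>, which
  contributes the shape.\<close>

lemma pd2_X_pd2_F:
  assumes "u \<in> S"
  shows "pd p (pd k X) u \<bullet> pd l (pd j F) u = - (\<Sum>m\<in>UNIV. \<Sum>n\<in>UNIV. G u $ m $ n *
    (dual m u \<bullet> pd l (pd j F) u) * (dual n u \<bullet> pd p (pd k F) u)) - G u $ j $ l * shape k p u"
proof -
  have "pd p (pd k X) u \<bullet> pd l (pd j F) u
    = (\<Sum>m\<in>UNIV. (dual m u \<bullet> pd l (pd j F) u) * (pd m X u \<bullet> pd p (pd k F) u)) - G u $ j $ l * shape k p u"
    by (subst frame_expansion[OF assms, of "pd l (pd j F) u"])
      (simp add: inner_add_right inner_sum_right pd2_X_F[OF assms] pd2_X_Y[OF assms] G_nth shape_def)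
  also have "(\<Sum>m\<in>UNIV. (dual m u \<bullet> pd l (pd j F) u) * (pd m X u \<bullet> pd p (pd k F) u))
    = - (\<Sum>m\<in>UNIV. \<Sum>n\<in>UNIV. G u $ m $ n *
    (dual m u \<bullet> pd l (pd j F) u) * (dual n u \<bullet> pd p (pd k F) u))"
    by (simp add: pd_X[OF assms] inner_sum_left sum_distrib_left sum_negf mult_ac)
  finally show ?thesis .
qed

text \<open>Commutation of the second derivatives of \<open>G\<close>; the terms quadratic in the connection cancel by the symmetry of \<open>K\<close>.\<close>

lemma gauss_equation:
  assumes "u \<in> S"
  shows "G u $ j $ l * shape k p u + G u $ k $ l * shape j p u =
    G u $ j $ p * shape k l u + G u $ k $ p * shape j l u"
proof -
  let ?R = "\<lambda>l v. - (pd k X v \<bullet> pd l (pd j F) v) - pd j X v \<bullet> pd l (pd k F) v"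
  have eq: "pd l (\<lambda>v. G v $ j $ k) v = ?R l v" if "v \<in> S" for l v
    by (rule pd_G_flat[OF that])
  have parts: "(\<lambda>v. pd a X v \<bullet> pd l (pd b F) v) differentiable (at u)"
    "pd p (\<lambda>v. pd a X v \<bullet> pd l (pd b F) v) u
      = pd a X u \<bullet> pd p (pd l (pd b F)) u + pd p (pd a X) u \<bullet> pd l (pd b F) u" for l p a b
    by (intro pd_inner pd_X_diff F_diff assms)+
  have R_diff: "?R l differentiable (at u)" for l
    by (intro differentiable_diff differentiable_minus parts)
  have R_pd: "pd p (?R l) u = - (pd k X u \<bullet> pd p (pd l (pd j F)) u + pd p (pd k X) u \<bullet> pd l (pd j F) u)
      - (pd j X u \<bullet> pd p (pd l (pd k F)) u + pd p (pd j X) u \<bullet> pd l (pd k F) u)" for p l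
    using parts by (simp add: pd_diff pd_minus differentiable_minus)
  have diff: "pd l (\<lambda>v. G v $ j $ k) differentiable (at u)" for l
    by (rule differentiable_transform_open[OF R_diff open_S assms eq[symmetric]])
  have "pd p (pd l (\<lambda>v. G v $ j $ k)) u = pd l (pd p (\<lambda>v. G v $ j $ k)) u"
    by (rule pd_commute[OF open_S assms G_diff diff diff])
  moreover have "pd p (pd l (\<lambda>v. G v $ j $ k)) u = pd p (?R l) u" for p l
    by (rule pd_transform[OF open_S assms eq])
  ultimately have "pd p (?R l) u = pd l (?R p) u" by simp
  then have *: "pd p (pd k X) u \<bullet> pd l (pd j F) u + pd p (pd j X) u \<bullet> pd l (pd k F) u
      = pd l (pd k X) u \<bullet> pd p (pd j F) u + pd l (pd j X) u \<bullet> pd p (pd k F) u"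
    unfolding R_pd using F3_sym[OF assms, of p l j] F3_sym[OF assms, of p l k] by simp
  define K where "K w z = (\<Sum>m\<in>UNIV. \<Sum>n\<in>UNIV. G u $ m $ n * (dual m u \<bullet> w) * (dual n u \<bullet> z))" for w z
  have K_sym: "K w z = K z w" for w z
    unfolding K_def by (subst sum.swap) (simp add: mult_ac G_sym[OF assms])
  from * show ?thesis
    unfolding pd2_X_pd2_F[OF assms] K_def[symmetric]
    using K_sym[of "pd l (pd j F) u" "pd p (pd k F) u"] K_sym[of "pd l (pd k F) u" "pd p (pd j F) u"]
    by simp
qed

text \<open>The relative mean curvature. It is the only candidate for the factor
  \<open>\<lambda>\<close>, since the trace of \<open>\<lambda> G\<close> is
  \<open>n \<lambda>\<close>.\<close>

definition affine_curvature :: "real^'n \<Rightarrow> real" where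
  "affine_curvature u = (\<Sum>j\<in>UNIV. \<Sum>l\<in>UNIV. rel_metric_inv F Y u $ j $ l * shape j l u) / real CARD('n)"

text \<open>Contract \<open>gauss_equation\<close> over \<open>j\<close> and \<open>l\<close> with
  the inverse metric: the left side becomes \<open>n + 1\<close> times the shape, the right side the
  shape plus \<open>n \<lambda> G\<close>.\<close>

lemma shape_umbilic:
  assumes "u \<in> S"
  shows "shape k p u = affine_curvature u * G u $ k $ p"
proof -
  let ?R = "\<lambda>j l. rel_metric_inv F Y u $ j $ l"
  note inv1 = rel_metric_inv_G[OF assms]
  have inv2: "(\<Sum>l\<in>UNIV. ?R j l * G u $ k $ l) = of_bool (j = k)" for j k
  proof -
    have "(rel_metric_inv F Y u ** G u) $ j $ k = of_bool (j = k)"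
      using matrix_inv_mult(2)[OF det_G[OF assms]] by (simp add: rel_metric_inv_def mat_def)
    then show ?thesis by (simp add: matrix_matrix_mult_def G_sym[OF assms, of k])
  qed
  have "(\<Sum>j\<in>UNIV. \<Sum>l\<in>UNIV. ?R j l * (G u $ j $ l * shape k p u + G u $ k $ l * shape j p u))
      = (\<Sum>j\<in>UNIV. (\<Sum>l\<in>UNIV. ?R j l * G u $ j $ l) * shape k p u + (\<Sum>l\<in>UNIV. ?R j l * G u $ k $ l) * shape j p u)"
    by (simp add: distrib_left sum.distrib sum_distrib_left sum_distrib_right mult_ac)
  also have "\<dots> = real CARD('n) * shape k p u + shape k p u"
    by (simp add: inv2 sum.distrib)
  finally have lhs: "(\<Sum>j\<in>UNIV. \<Sum>l\<in>UNIV. ?R j l * (G u $ j $ l * shape k p u + G u $ k $ l * shape j p u)) = \<dots>" .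
  have "(\<Sum>j\<in>UNIV. \<Sum>l\<in>UNIV. ?R j l * (G u $ j $ p * shape k l u + G u $ k $ p * shape j l u))
      = (\<Sum>j\<in>UNIV. \<Sum>l\<in>UNIV. shape k l u * (?R j l * G u $ j $ p)) + (\<Sum>j\<in>UNIV. \<Sum>l\<in>UNIV. ?R j l * shape j l u) * G u $ k $ p"
    by (simp add: distrib_left sum.distrib sum_distrib_left sum_distrib_right mult_ac)
  also have "(\<Sum>j\<in>UNIV. \<Sum>l\<in>UNIV. shape k l u * (?R j l * G u $ j $ p)) = shape k p u"
    by (subst sum.swap) (simp add: inv1 flip: sum_distrib_left)
  finally have rhs: "(\<Sum>j\<in>UNIV. \<Sum>l\<in>UNIV. ?R j l * (G u $ j $ p * shape k l u + G u $ k $ p * shape j l u))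
      = shape k p u + real CARD('n) * affine_curvature u * G u $ k $ p"
    by (simp add: affine_curvature_def)
  have "real CARD('n) * shape k p u = real CARD('n) * (affine_curvature u * G u $ k $ p)"
    using lhs rhs gauss_equation[OF assms, of _ _ k p] by simp
  then show ?thesis by simp
qed

text \<open>By \<open>pd_X\<close> and the invertibility of \<open>G\<close>, the
  \<open>X\<^sub>k\<close> span the same space as the dual vectors of the
  \<open>F\<^sub>i\<close>.\<close>

lemma tangential_ext:
  assumes "u \<in> S" "X u \<bullet> w = 0" "\<And>k. pd k X u \<bullet> w = 0"
  shows "w = 0"
proof -
  let ?c = "\<lambda>m. dual m u \<bullet> w"
  have "(\<Sum>m\<in>UNIV. G u $ k $ m * ?c m) = 0" for k
    using assms(3)[of k] by (simp add: pd_X[OF assms(1)] inner_sum_left)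
  then have "G u *v (\<chi> m. ?c m) = 0" by (simp add: vec_eq_iff matrix_vector_mult_def)
  then have "(matrix_inv (G u) ** G u) *v (\<chi> m. ?c m) = 0"
    by (simp add: matrix_vector_mul_assoc[symmetric])
  then have "(\<chi> m. ?c m) = 0" using matrix_inv_mult(2)[OF det_G[OF assms(1)]] by simp
  then have "?c m = 0" for m by (simp add: vec_eq_iff)
  then show ?thesis using frame_expansion[OF assms(1), of w] assms(2) by simp
qed

lemma pd_Y:
  assumes "u \<in> S"
  shows "pd p Y u = - affine_curvature u *\<^sub>R pd p F u"
proof -
  have "pd p Y u + affine_curvature u *\<^sub>R pd p F u = 0"
  proof (rule tangential_ext[OF assms])
    show "X u \<bullet> (pd p Y u + affine_curvature u *\<^sub>R pd p F u) = 0"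
      using tangential_inner[OF assms X_F[OF assms]] by (simp add: inner_add_right X_F assms)
    show "pd k X u \<bullet> (pd p Y u + affine_curvature u *\<^sub>R pd p F u) = 0" for k
      using shape_umbilic[OF assms, of k p]
      by (simp add: inner_add_right shape_def pd_X_F[OF assms] G_sym[OF assms, of p k])
  qed
  then show ?thesis by (simp add: eq_neg_iff_add_eq_0)
qed

lemma affine_curvature_locally_constant:
  assumes "u \<in> S"
  obtains U where "open U" "u \<in> U" "U \<subseteq> S" "\<And>v. v \<in> U \<Longrightarrow> affine_curvature v = affine_curvature u"
proof -
  have "continuous_on S (pd i F)" for i
    by (intro differentiable_imp_continuous_on differentiable_at_imp_differentiable_on F_diff)
  from proportional_derivative_locally_constant[OF open_S assms dim F_diff(1) this Y_diff pd_Y dual_F[OF assms]]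
  show ?thesis using that by blast
qed

text \<open>The symmetric form that is \<open>G\<close> on the tangent space and \<open>c\<close> on
  \<open>Y\<close>, with \<open>Y\<close> orthogonal to the tangent space. \<open>c\<close> is a
  fixed number, later the locally constant value of \<open>affine_curvature\<close>, so that only
  \<open>G\<close>, \<open>dual\<close> and \<open>X\<close> get differentiated.\<close>

definition quadric_matrix :: "real \<Rightarrow> real^'n \<Rightarrow> real^('n option)^('n option)" where
  "quadric_matrix c u = (\<chi> a b. (\<Sum>i\<in>UNIV. \<Sum>j\<in>UNIV. G u $ i $ j * dual i u $ a * dual j u $ b)
     + c * X u $ a * X u $ b)"

lemma quadric_matrix_mult:
  "quadric_matrix c u *v w = (\<Sum>i\<in>UNIV. (\<Sum>j\<in>UNIV. G u $ i $ j * (dual j u \<bullet> w)) *\<^sub>R dual i u)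
     + (c * (X u \<bullet> w)) *\<^sub>R X u"
proof -
  have "(quadric_matrix c u *v w) $ a = ((\<Sum>i\<in>UNIV. (\<Sum>j\<in>UNIV. G u $ i $ j * (dual j u \<bullet> w)) *\<^sub>R dual i u)
     + (c * (X u \<bullet> w)) *\<^sub>R X u) $ a" for a
  proof -
    have "(quadric_matrix c u *v w) $ a = (\<Sum>b\<in>UNIV. \<Sum>i\<in>UNIV. \<Sum>j\<in>UNIV. G u $ i $ j * dual i u $ a * (dual j u $ b * w $ b))
       + (\<Sum>b\<in>UNIV. c * X u $ a * (X u $ b * w $ b))"
      by (simp add: matrix_vector_mult_def quadric_matrix_def distrib_left distrib_right sum.distrib
          sum_distrib_left sum_distrib_right mult_ac)
    also have "(\<Sum>b\<in>UNIV. \<Sum>i\<in>UNIV. \<Sum>j\<in>UNIV. G u $ i $ j * dual i u $ a * (dual j u $ b * w $ b))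
       = (\<Sum>i\<in>UNIV. \<Sum>j\<in>UNIV. \<Sum>b\<in>UNIV. G u $ i $ j * dual i u $ a * (dual j u $ b * w $ b))"
      by (subst sum.swap, rule sum.cong[OF refl], rule sum.swap)
    finally show ?thesis by (simp add: inner_vec_def sum_distrib_left sum_distrib_right mult_ac)
  qed
  then show ?thesis by (simp add: vec_eq_iff)
qed

lemma quadric_matrix_F:
  assumes "u \<in> S" shows "quadric_matrix c u *v pd j F u = - pd j X u"
  by (simp add: quadric_matrix_mult dual_F[OF assms] X_F[OF assms] pd_X[OF assms] G_sym[OF assms, of j])

lemma quadric_matrix_Y:
  assumes "u \<in> S" shows "quadric_matrix c u *v Y u = c *\<^sub>R X u"
  by (simp add: quadric_matrix_mult dual_Y[OF assms] X_Y[OF assms])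

lemma quadric_matrix_sym:
  assumes "u \<in> S" shows "transpose (quadric_matrix c u) = quadric_matrix c u"
proof -
  have "(\<Sum>i\<in>UNIV. \<Sum>j\<in>UNIV. G u $ i $ j * dual i u $ b * dual j u $ a)
      = (\<Sum>i\<in>UNIV. \<Sum>j\<in>UNIV. G u $ i $ j * dual i u $ a * dual j u $ b)" for a b
    by (subst sum.swap) (simp add: G_sym[OF assms] mult_ac)
  then show ?thesis by (simp add: vec_eq_iff transpose_def quadric_matrix_def mult_ac)
qed

lemma quadric_matrix_diff:
  assumes "u \<in> S" shows "quadric_matrix c differentiable (at u)"
proof (rule differentiable_vec, rule differentiable_vec)
  show "(\<lambda>v. quadric_matrix c v $ a $ b) differentiable (at u)" for a b
    unfolding quadric_matrix_def
    by (simp, intro differentiable_add differentiable_sum differentiable_mult ballI finite differentiable_const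
        G_diff differentiable_nth dual_diff X_diff assms)
qed

text \<open>Differentiating \<open>A F\<^sub>j = - X\<^sub>j\<close> and \<open>A Y = c X\<close>
  shows that the derivative of \<open>A\<close> annihilates the frame, once
  \<open>A F\<^sub>j\<^sub>l = - X\<^sub>j\<^sub>l\<close> is known. The latter is tested on the
  frame: paired with \<open>F\<^sub>m\<close> it is \<open>pd2_X_F\<close>, paired with
  \<open>Y\<close> it is \<open>shape_umbilic\<close>.\<close>

lemma pd_quadric_matrix:
  assumes "u \<in> S" "affine_curvature u = c"
  shows "pd l (quadric_matrix c) u = 0"
proof -
  let ?A = "quadric_matrix c"
  note u = assms(1)
  note prod = pd_bounded_bilinear(1)[OF bounded_bilinear_matrix_vector_mult quadric_matrix_diff[OF u]]
  have A_sym: "(?A u *v w) \<bullet> z = w \<bullet> (?A u *v z)" for w z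
    by (simp only: dot_lmul_matrix[symmetric] transpose_matrix_vector[symmetric] quadric_matrix_sym[OF u])
  have *: "?A u *v pd l (pd j F) u = - pd l (pd j X) u" for j
  proof (rule frame_eqI[OF u])
    show "(?A u *v pd l (pd j F) u) \<bullet> pd m F u = - pd l (pd j X) u \<bullet> pd m F u" for m
      unfolding A_sym quadric_matrix_F[OF u] inner_minus_left inner_minus_right pd2_X_F[OF u]
      by (simp only: inner_commute)
    show "(?A u *v pd l (pd j F) u) \<bullet> Y u = - pd l (pd j X) u \<bullet> Y u"
      unfolding A_sym quadric_matrix_Y[OF u] inner_minus_left pd2_X_Y[OF u]
      using shape_umbilic[OF u, of j l] assms(2)
      by (simp add: G_nth shape_def inner_commute)
  qed
  have F0: "pd l ?A u *v pd j F u = 0" for j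
  proof -
    have "pd l (\<lambda>v. ?A v *v pd j F v) u = pd l (\<lambda>v. - pd j X v) u"
      by (rule pd_transform[OF open_S u]) (rule quadric_matrix_F)
    then show ?thesis
      by (simp add: prod[OF F_diff(2)[OF u]] pd_minus[OF pd_X_diff[OF u]] *)
  qed
  have Y0: "pd l ?A u *v Y u = 0"
  proof -
    have "pd l (\<lambda>v. ?A v *v Y v) u = pd l (\<lambda>v. c *\<^sub>R X v) u"
      by (rule pd_transform[OF open_S u]) (rule quadric_matrix_Y)
    moreover have "?A u *v pd l Y u = c *\<^sub>R pd l X u"
      unfolding pd_Y[OF u] matrix_vector_mult_scaleR quadric_matrix_F[OF u] assms(2) by simp
    ultimately show ?thesis
      by (simp add: prod[OF Y_diff[OF u]] pd_bounded_linear(1)[OF bounded_linear_scaleR_right X_diff[OF u]])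
  qed
  have "pd l ?A u *v w = 0" for w
    by (subst frame_expansion[OF u, of w])
      (simp add: matrix_vector_right_distrib matrix_vector_mult_scaleR F0 Y0 linear_sum[OF matrix_vector_mul_linear])
  then show ?thesis by (simp add: matrix_eq)
qed

lemma local_quadric:
  assumes "u \<in> S"
  obtains U A b k where "open U" "u \<in> U" "U \<subseteq> S" "transpose A = A"
    "\<And>v. v \<in> U \<Longrightarrow> F v \<bullet> (A *v F v) + 2 * (b \<bullet> F v) + k = 0"
    "\<And>v. v \<in> U \<Longrightarrow> (A *v F v + b) \<bullet> Y v = - 1"
proof -
  obtain U0 where U0: "open U0" "u \<in> U0" "U0 \<subseteq> S"
    and c: "\<And>v. v \<in> U0 \<Longrightarrow> affine_curvature v = affine_curvature u"
    using affine_curvature_locally_constant[OF assms] by blast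
  obtain e where "e > 0" and e: "ball u e \<subseteq> U0"
    using U0 open_contains_ball by blast
  let ?U = "ball u e" and ?c = "affine_curvature u"
  have US: "v \<in> S" if "v \<in> ?U" for v using that e U0(3) by blast
  note const = pd_zero_imp_const[of ?U, OF open_ball connected_ball]
  have u: "u \<in> ?U" using \<open>e > 0\<close> by simp
  define A where "A = quadric_matrix ?c u"
  have A: "quadric_matrix ?c v = A" if "v \<in> ?U" for v
    unfolding A_def
    by (rule const[OF quadric_matrix_diff pd_quadric_matrix that u]) (use US c e in auto)
  have AF: "A *v pd j F v = - pd j X v" if "v \<in> ?U" for j v
    using quadric_matrix_F[OF US[OF that], of ?c j] A[OF that] by simp
  have A_sym: "transpose A = A" unfolding A_def by (rule quadric_matrix_sym[OF assms])
  have A_sym': "w \<bullet> (A *v z) = z \<bullet> (A *v w)" for w z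
  proof -
    have "w \<bullet> (A *v z) = (transpose A *v w) \<bullet> z"
      by (simp only: transpose_matrix_vector dot_lmul_matrix)
    then show ?thesis by (simp only: A_sym inner_commute[of z])
  qed
  note linA = pd_bounded_linear[OF matrix_vector_mul_bounded_linear[of A]]
  define b where "b = - (X u + A *v F u)"
  have b: "A *v F v + b = - X v" if "v \<in> ?U" for v
  proof -
    have "X v + A *v F v = X u + A *v F u"
    proof (rule const[OF _ _ that u])
      fix v i assume v: "v \<in> ?U"
      show "(\<lambda>v. X v + A *v F v) differentiable (at v)"
        by (intro differentiable_add X_diff linA F_diff US v)
      show "pd i (\<lambda>v. X v + A *v F v) v = 0"
        using AF[OF v] by (simp add: linA(1)[OF F_diff(1)[OF US[OF v]]]
            pd_add[OF X_diff[OF US[OF v]] linA(2)[OF F_diff(1)[OF US[OF v]]]])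
    qed
    then have "b = - (X v + A *v F v)" by (simp only: b_def)
    then show ?thesis by simp
  qed
  \<comment> \<open>The derivative of this function is twice
    \<open>(A F + b) \<bullet> F\<^sub>i = - X \<bullet> F\<^sub>i = 0\<close>.\<close>
  let ?Q = "\<lambda>v. F v \<bullet> (A *v F v) + 2 * (b \<bullet> F v)"
  have Q: "?Q v = ?Q u" if "v \<in> ?U" for v
  proof (rule const[OF _ _ that u])
    fix v i assume v: "v \<in> ?U"
    note Fv = F_diff(1)[OF US[OF v]]
    note q1 = pd_inner[OF Fv linA(2)[OF Fv]]
    note q2 = pd_bounded_linear[OF bounded_linear_compose[OF bounded_linear_mult_right[of 2] bounded_linear_inner_right[of b]] Fv]
    show "?Q differentiable (at v)" by (intro differentiable_add q1 q2)
    have "pd i ?Q v = F v \<bullet> (A *v pd i F v) + pd i F v \<bullet> (A *v F v) + 2 * (b \<bullet> pd i F v)"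
      by (simp only: pd_add[OF q1(2) q2(2)] q1(1) q2(1) linA(1)[OF Fv])
    also have "\<dots> = 2 * ((A *v F v + b) \<bullet> pd i F v)"
      using A_sym'[of "F v" "pd i F v"] by (simp add: inner_add_right inner_commute)
    also have "\<dots> = 0" using X_F[OF US[OF v]] by (simp add: b[OF v])
    finally show "pd i ?Q v = 0" .
  qed
  show ?thesis
  proof (rule that[of ?U A b "- ?Q u"])
    show "F v \<bullet> (A *v F v) + 2 * (b \<bullet> F v) + - ?Q u = 0" if "v \<in> ?U" for v
      using Q[OF that] by simp
    show "(A *v F v + b) \<bullet> Y v = - 1" if "v \<in> ?U" for v
      by (simp add: b[OF that] X_Y[OF US[OF that]])
  qed (use u A_sym US in auto)
qed

end

section \<open>Quadrics and the Gaussian curvature\<close>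

lemma det_scaleR:
  fixes A :: "real^'n::finite^'n"
  shows "det (c *\<^sub>R A) = c ^ CARD('n) * det A"
proof -
  have "c *\<^sub>R A = (\<chi> i. c *s A $ i)" by (simp add: vec_eq_iff)
  then show ?thesis using det_rows_mul[of "\<lambda>_. c" "\<lambda>i. A $ i"] by (simp add: vec_lambda_eta)
qed

text \<open>The matrix of the quadric \<open>v \<bullet> A v + 2 b \<bullet> v + k = 0\<close> in
  homogeneous coordinates, with \<open>None\<close> as the homogenizing index.\<close>

definition bordered :: "real^'m::finite^'m \<Rightarrow> real^'m \<Rightarrow> real \<Rightarrow> real^('m option)^('m option)" where
  "bordered A b k = (\<chi> r c. case r of
     None \<Rightarrow> (case c of None \<Rightarrow> k | Some j \<Rightarrow> b $ j)
   | Some i \<Rightarrow> (case c of None \<Rightarrow> b $ i | Some j \<Rightarrow> A $ i $ j))"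

text \<open>\<open>t = 1\<close> marks points, \<open>t = 0\<close> directions.\<close>

definition homog :: "real \<Rightarrow> real^'m::finite \<Rightarrow> real^('m option)" where
  "homog t v = (\<chi> c. case c of None \<Rightarrow> t | Some i \<Rightarrow> v $ i)"

lemma bordered_form:
  "homog t v \<bullet> (bordered A b k *v homog s w) = t * s * k + t * (b \<bullet> w) + s * (b \<bullet> v) + v \<bullet> (A *v w)"
proof -
  have None: "(bordered A b k *v homog s w) $ None = s * k + b \<bullet> w"
    by (simp add: matrix_vector_mult_def sum_UNIV_option bordered_def homog_def inner_vec_def)
  have Some: "(bordered A b k *v homog s w) $ Some i = s * b $ i + (A *v w) $ i" for i
    by (simp add: matrix_vector_mult_def sum_UNIV_option bordered_def homog_def)
  have inner: "homog t v \<bullet> z = t * z $ None + (\<Sum>i\<in>UNIV. v $ i * z $ Some i)" for z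
    by (simp add: inner_vec_def sum_UNIV_option homog_def)
  show ?thesis
    unfolding inner None Some by (simp add: distrib_left sum.distrib inner_vec_def sum_distrib_left mult_ac)
qed

section \<open>Gaussian curvature in terms of the relative metric\<close>

context relative_patch
begin

text \<open>The Gram matrix of the frame with the unit normal splits into the entry 1 and the first
  fundamental form.\<close>

lemma det_first_form:
  assumes "u \<in> S"
  shows "det (first_form F u) = (det (frame F u (unit_normal F u)))\<^sup>2"
proof -
  let ?\<nu> = "unit_normal F u"
  let ?N = "frame F u ?\<nu>"
  have nu: "?\<nu> \<bullet> ?\<nu> = 1" "?\<nu> \<bullet> pd i F u = 0" for i
    using covector_eq_column(2)[OF assms]
    by (simp add: norm_eq_1, simp add: covector_eq_column(3)[OF assms] X_F[OF assms])
  have M: "(?N ** transpose ?N) $ a $ b = ?N $ a \<bullet> ?N $ b" for a b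
    by (simp add: matrix_matrix_mult_def transpose_def inner_vec_def)
  have "det (?N ** transpose ?N) = (?N ** transpose ?N) $ None $ None *
      det (\<chi> i j. (?N ** transpose ?N) $ Some i $ Some j)"
    by (rule det_option) (simp only: M frame_None frame_Some nu)
  also have "\<dots> = det (first_form F u)"
    by (simp only: M frame_None frame_Some nu first_form_def mult_1)
  finally show ?thesis by (simp add: det_mul power2_eq_square)
qed

lemma second_form_eq:
  assumes "u \<in> S"
  shows "second_form F u = support_function F Y u *\<^sub>R G u"
  by (simp add: vec_eq_iff second_form_def G_nth covector_eq_column(3)[OF assms])

text \<open>Of the factors \<open>q\<close>, \<open>CARD('n)\<close> come from
  \<open>second_form_eq\<close> and two from \<open>det (E u) = q * N\<close>, where
  \<open>N\<^sup>2\<close> is the determinant of the first form.\<close>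

lemma gauss_curvature_eq:
  assumes "u \<in> S"
  shows "gauss_curvature F u * (det (E u))\<^sup>2 = support_function F Y u ^ (CARD('n) + 2) * det (G u)"
proof -
  let ?N = "det (frame F u (unit_normal F u))" and ?q = "support_function F Y u"
  have E: "?N * ?q = det (E u)" by (rule covector_eq_column(4)[OF assms])
  then have "?N \<noteq> 0" using det_E[OF assms] by auto
  have "gauss_curvature F u * (?N * ?q)\<^sup>2 = ?q ^ CARD('n) * det (G u) * ?q\<^sup>2"
    using \<open>?N \<noteq> 0\<close>
    by (simp add: gauss_curvature_def second_form_eq[OF assms] det_scaleR det_first_form[OF assms] power_mult_distrib)
  then show ?thesis unfolding E by (simp add: power_add power2_eq_square mult_ac)
qed

end

section \<open>Normalized quadrics through a patch\<close>

context nondegenerate_patch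
begin

text \<open>Differentiating the equation of the quadric makes \<open>A F + b\<close> normal to the
  hypersurface; the pairing with \<open>Y\<close> fixes its length and sign.\<close>

lemma quadric_gradient:
  assumes "open U" "u \<in> U" "U \<subseteq> S" "transpose A = A"
    and Q: "\<And>v. v \<in> U \<Longrightarrow> F v \<bullet> (A *v F v) + 2 * (b \<bullet> F v) + k = 0"
    and "(A *v F u + b) \<bullet> Y u = - 1"
  shows "A *v F u + b = - X u"
proof -
  have u: "u \<in> S" using assms by blast
  have A_sym: "w \<bullet> (A *v z) = z \<bullet> (A *v w)" for w z
  proof -
    have "w \<bullet> (A *v z) = (transpose A *v w) \<bullet> z"
      by (simp only: transpose_matrix_vector dot_lmul_matrix)
    then show ?thesis by (simp only: assms(4) inner_commute[of z])
  qed
  note Fu = F_diff(1)[OF u]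
  note linA = pd_bounded_linear[OF matrix_vector_mul_bounded_linear[of A] Fu]
  note q1 = pd_inner[OF Fu linA(2)]
  note q2 = pd_bounded_linear[OF bounded_linear_compose[OF bounded_linear_mult_right[of 2] bounded_linear_inner_right[of b]] Fu]
  have "(A *v F u + b) \<bullet> pd i F u = 0" for i
  proof -
    have "pd i (\<lambda>v. F v \<bullet> (A *v F v) + 2 * (b \<bullet> F v)) u = 0"
      by (rule pd_zero_on[OF assms(1,2), of _ "- k"]) (use Q in \<open>simp add: eq_neg_iff_add_eq_0\<close>)
    then have "F u \<bullet> (A *v pd i F u) + pd i F u \<bullet> (A *v F u) + 2 * (b \<bullet> pd i F u) = 0"
      by (simp only: pd_add[OF q1(2) q2(2)] q1(1) q2(1) linA(1))
    then show ?thesis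
      using A_sym[of "F u" "pd i F u"] by (simp add: inner_add_right inner_commute)
  qed
  then show ?thesis
    using assms(6) by (intro frame_eqI[OF u]) (simp_all add: X_F[OF u] X_Y[OF u])
qed

text \<open>Both gradients are \<open>- X\<close>, so \<open>D F = b' - b\<close> is constant and
  \<open>D\<close> annihilates \<open>F\<^sub>i\<close> and \<open>F\<^sub>i\<^sub>j\<close>. Some
  \<open>G\<^sub>i\<^sub>j\<close> is nonzero, so one of the \<open>F\<^sub>i\<^sub>j\<close> has a
  component along \<open>Y\<close>, and \<open>D\<close> annihilates \<open>Y\<close> as
  well.\<close>

lemma quadric_unique:
  assumes U: "open U" "u \<in> U" "U \<subseteq> S"
    and A: "transpose A = A" "transpose A' = A'"
    and Q: "\<And>v. v \<in> U \<Longrightarrow> F v \<bullet> (A *v F v) + 2 * (b \<bullet> F v) + k = 0"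
      "\<And>v. v \<in> U \<Longrightarrow> F v \<bullet> (A' *v F v) + 2 * (b' \<bullet> F v) + k' = 0"
    and N: "\<And>v. v \<in> U \<Longrightarrow> (A *v F v + b) \<bullet> Y v = - 1" "\<And>v. v \<in> U \<Longrightarrow> (A' *v F v + b') \<bullet> Y v = - 1"
  shows "A = A'" "b = b'" "k = k'"
proof -
  have US: "v \<in> S" if "v \<in> U" for v using U that by blast
  have u: "u \<in> S" by (rule US[OF U(2)])
  define D where "D = A - A'"
  have D0: "D *v F v = b' - b" if "v \<in> U" for v
    using quadric_gradient[OF U(1) that U(3) A(1) Q(1) N(1)[OF that]]
      quadric_gradient[OF U(1) that U(3) A(2) Q(2) N(2)[OF that]]
    by (simp add: D_def matrix_vector_mult_diff_rdistrib algebra_simps)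
  note lin = pd_bounded_linear(1)[OF matrix_vector_mul_bounded_linear[of D]]
  have D1: "D *v pd i F v = 0" if "v \<in> U" for i v
    using pd_zero_on[OF U(1) that D0, where i = i] lin[OF F_diff(1)[OF US[OF that]], of i] by simp
  have D2: "D *v pd j (pd i F) u = 0" for i j
  proof -
    have "pd j (\<lambda>v. D *v pd i F v) u = 0"
      by (rule pd_zero_on[OF U(1,2) D1])
    then show ?thesis using lin[OF F_diff(2)[OF u]] by simp
  qed
  have "\<exists>i j. G u $ i $ j \<noteq> 0"
  proof (rule ccontr)
    assume "\<not> (\<exists>i j. G u $ i $ j \<noteq> 0)"
    then have "G u = mat 0" by (simp add: vec_eq_iff mat_def)
    then show False using det_G[OF u] by (simp only: det_0)
  qed
  then obtain i j where ij: "G u $ i $ j \<noteq> 0" by blast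
  have sum: "D *v (\<Sum>m\<in>UNIV. c m *\<^sub>R pd m F u) = 0" for c
    by (simp add: linear_sum[OF matrix_vector_mul_linear] matrix_vector_mult_scaleR D1[OF U(2)])
  have "D *v pd j (pd i F) u = G u $ i $ j *\<^sub>R (D *v Y u)"
    by (subst frame_expansion[OF u, of "pd j (pd i F) u"])
      (simp only: matrix_vector_right_distrib matrix_vector_mult_scaleR sum G_nth add_0_left)
  then have DY: "D *v Y u = 0" using ij D2 by simp
  have "D *v w = 0" for w
    by (subst frame_expansion[OF u, of w])
      (simp only: matrix_vector_right_distrib matrix_vector_mult_scaleR sum DY scaleR_zero_right add_0_left)
  then have "D = 0" by (simp add: matrix_eq)
  then show AA: "A = A'" by (simp add: D_def)
  show bb: "b = b'" using D0[OF U(2)] \<open>D = 0\<close> by simp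
  show "k = k'" using Q(1)[OF U(2)] Q(2)[OF U(2)] by (simp add: AA bb)
qed

text \<open>For the point \<open>F\<close> and the directions \<open>Y\<close>,
  \<open>F\<^sub>i\<close> the Gram matrix of the homogenized form consists of \<open>G\<close> and
  a 2 by 2 block, with 0 at the point and \<open>- 1\<close> off its diagonal. The basis has
  determinant \<open>det (E u)\<close>.\<close>

lemma quadric_det:
  assumes U: "open U" "u \<in> U" "U \<subseteq> S" and A: "transpose A = A"
    and Q: "\<And>v. v \<in> U \<Longrightarrow> F v \<bullet> (A *v F v) + 2 * (b \<bullet> F v) + k = 0"
    and N: "\<And>v. v \<in> U \<Longrightarrow> (A *v F v + b) \<bullet> Y v = - 1"
  shows "\<bar>det (G u)\<bar> = \<bar>det (bordered A b k)\<bar> * (det (E u))\<^sup>2" "A \<noteq> 0"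
proof -
  have u: "u \<in> S" using U by blast
  have grad: "A *v F v + b = - X v" if "v \<in> U" for v
    by (rule quadric_gradient[OF U(1) that U(3) A Q N[OF that]])
  have AF: "A *v pd i F u = - pd i X u" for i
  proof -
    have "pd i (\<lambda>v. A *v F v) u = pd i (\<lambda>v. - X v - b) u"
      by (rule pd_transform[OF U(1,2)]) (use grad in \<open>simp add: eq_diff_eq\<close>)
    also have "\<dots> = - pd i X u"
      by (simp add: pd_diff pd_minus X_diff[OF u])
    finally show ?thesis
      by (simp add: pd_bounded_linear(1)[OF matrix_vector_mul_bounded_linear F_diff(1)[OF u]])
  qed
  have "\<exists>i j. G u $ i $ j \<noteq> 0"
  proof (rule ccontr)
    assume "\<not> (\<exists>i j. G u $ i $ j \<noteq> 0)"
    then have "G u = mat 0" by (simp add: vec_eq_iff mat_def)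
    then show False using det_G[OF u] by (simp only: det_0)
  qed
  then obtain i j where "G u $ i $ j \<noteq> 0" by blast
  then show "A \<noteq> 0" using AF[of j] pd_X_F[OF u, of j i] by auto
  let ?B = "bordered A b k"
  define row where "row r = (case r of None \<Rightarrow> homog 1 (F u) | Some a \<Rightarrow> homog 0 (E u $ a))" for r
  define P where "P = (\<chi> r. row r)"
  \<comment> \<open>Exchanging the point and \<open>Y\<close> on one side moves the entries
    \<open>- 1\<close> to the diagonal and makes the matrix triangular up to the block
    \<open>G\<close>. The value of the form at \<open>(Y, Y)\<close> lands below the diagonal, where
    it does not affect the determinant.\<close>
  define \<sigma> where "\<sigma> = Transposition.transpose None (Some None :: 'n option option)"
  define P' where "P' = (\<chi> r. P $ \<sigma> r)"
  have detP: "det P = det (E u)"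
  proof -
    have "det (transpose P) = transpose P $ None $ None * det (\<chi> i j. transpose P $ Some i $ Some j)"
      by (rule det_option) (simp add: transpose_def P_def row_def homog_def)
    also have "(\<chi> i j. transpose P $ Some i $ Some j) = transpose (E u)"
      by (simp add: vec_eq_iff transpose_def P_def row_def homog_def)
    also have "transpose P $ None $ None = 1"
      by (simp add: transpose_def P_def row_def homog_def)
    finally show ?thesis by simp
  qed
  have "\<sigma> permutes UNIV" unfolding \<sigma>_def by (rule permutes_swap_id) auto
  then have "det P' = of_int (sign \<sigma>) * det P"
    unfolding P'_def by (rule det_permute_rows)
  then have detP': "\<bar>det P'\<bar> = \<bar>det P\<bar>" by (simp add: sign_def)
  let ?M = "P ** ?B ** transpose P'"
  have M: "?M $ r $ s = row r \<bullet> (?B *v row (\<sigma> s))" for r s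
  proof -
    have "?M $ r $ s = (P *v (?B *v (P' $ s))) $ r"
      by (simp add: matrix_mul_assoc[symmetric]) (simp add: matrix_matrix_mult_def matrix_vector_mult_def transpose_def)
    then show ?thesis
      by (simp add: P'_def P_def matrix_vector_mult_def inner_vec_def)
  qed
  have \<sigma>: "\<sigma> None = Some None" "\<sigma> (Some None) = None" "\<sigma> (Some (Some i)) = Some (Some i)" for i
    by (simp_all add: \<sigma>_def)
  have val: "row None \<bullet> (?B *v row (Some None)) = -1" "row None \<bullet> (?B *v row None) = 0"
    "row None \<bullet> (?B *v row (Some (Some i))) = 0" "row (Some None) \<bullet> (?B *v row None) = -1"
    "row (Some None) \<bullet> (?B *v row (Some (Some i))) = 0"
    "row (Some (Some i)) \<bullet> (?B *v row (Some (Some j))) = G u $ i $ j" for i j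
  proof -
    have g: "F u \<bullet> (A *v w) + b \<bullet> w = - (X u \<bullet> w)" for w
    proof -
      have "F u \<bullet> (A *v w) = (A *v F u) \<bullet> w"
        by (subst (2) A[symmetric]) (simp only: transpose_matrix_vector dot_lmul_matrix)
      then have "F u \<bullet> (A *v w) + b \<bullet> w = (A *v F u + b) \<bullet> w" by (simp add: inner_add_left)
      then show ?thesis by (simp add: grad[OF U(2)])
    qed
    have "Y u \<bullet> (A *v F u) + b \<bullet> Y u = -1"
      using N[OF U(2)] by (simp add: inner_add_right inner_commute)
    then show "row (Some None) \<bullet> (?B *v row None) = -1"
      by (simp add: row_def bordered_form frame_None)
    show "row None \<bullet> (?B *v row (Some None)) = -1"
      using g[of "Y u"] by (simp add: row_def bordered_form frame_None X_Y[OF u])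
    show "row None \<bullet> (?B *v row None) = 0"
      using Q[OF U(2)] by (simp add: row_def bordered_form)
    show "row None \<bullet> (?B *v row (Some (Some i))) = 0"
      using g[of "pd i F u"] by (simp add: row_def bordered_form frame_Some X_F[OF u])
    show "row (Some None) \<bullet> (?B *v row (Some (Some i))) = 0"
      using pd_X_Y[OF u, of i] by (simp add: row_def bordered_form frame_None frame_Some AF inner_commute)
    show "row (Some (Some i)) \<bullet> (?B *v row (Some (Some j))) = G u $ i $ j"
      using pd_X_F[OF u, of j i] by (simp add: row_def bordered_form frame_Some AF inner_commute)
  qed
  have "?M $ None $ Some s = 0" for s
    by (cases s) (simp_all only: M \<sigma> val)
  then have "det ?M = ?M $ None $ None * det (\<chi> r s. ?M $ Some r $ Some s)"
    by (rule det_option)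
  also have "det (\<chi> r s. ?M $ Some r $ Some s) =
      (\<chi> r s. ?M $ Some r $ Some s) $ None $ None * det (\<chi> i j. (\<chi> r s. ?M $ Some r $ Some s) $ Some i $ Some j)"
    by (rule det_option) (simp only: vec_lambda_beta M \<sigma> val)
  also have "(\<chi> i j. (\<chi> r s. ?M $ Some r $ Some s) $ Some i $ Some j) = G u"
    by (simp only: vec_lambda_beta M \<sigma> val vec_eq_iff simp_thms)
  finally have "det ?M = det (G u)" by (simp only: vec_lambda_beta M \<sigma> val)
  then have "det (G u) = det P * det ?B * det P'" by (simp add: det_mul)
  then have "\<bar>det (G u)\<bar> = \<bar>det ?B\<bar> * (\<bar>det (E u)\<bar> * \<bar>det (E u)\<bar>)"
    by (simp only: abs_mult detP' detP mult_ac)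
  then show "\<bar>det (G u)\<bar> = \<bar>det ?B\<bar> * (det (E u))\<^sup>2"
    by (simp only: abs_mult_self_eq power2_eq_square)
qed

text \<open>The square of \<open>det (E u)\<close> occurs in both \<open>gauss_curvature_eq\<close>
  and \<open>quadric_det\<close> and cancels.\<close>

lemma support_eq_gauss_curvature:
  assumes "open U" "u \<in> U" "U \<subseteq> S" "transpose A = A"
    and "\<And>v. v \<in> U \<Longrightarrow> F v \<bullet> (A *v F v) + 2 * (b \<bullet> F v) + k = 0"
    and "\<And>v. v \<in> U \<Longrightarrow> (A *v F v + b) \<bullet> Y v = - 1"
  shows "\<bar>gauss_curvature F u\<bar> powr (1 / (real CARD('n) + 2)) =
    \<bar>det (bordered A b k)\<bar> powr (1 / (real CARD('n) + 2)) * support_function F Y u"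
    "det (bordered A b k) \<noteq> 0"
proof -
  let ?q = "support_function F Y u" and ?B = "bordered A b k"
  have u: "u \<in> S" using assms by blast
  have det: "\<bar>det (G u)\<bar> = \<bar>det ?B\<bar> * (det (E u))\<^sup>2" by (rule quadric_det(1)[OF assms])
  then show "det ?B \<noteq> 0" using det_G[OF u] by auto
  have q: "?q > 0" by (rule support_pos[OF u])
  have "\<bar>gauss_curvature F u\<bar> * (det (E u))\<^sup>2 = ?q ^ (CARD('n) + 2) * \<bar>det (G u)\<bar>"
    using arg_cong[OF gauss_curvature_eq[OF u], of abs] q by (simp add: abs_mult power_abs)
  then have K: "\<bar>gauss_curvature F u\<bar> = \<bar>det ?B\<bar> * ?q ^ (CARD('n) + 2)"
    unfolding det using det_E[OF u] by (simp add: mult_ac)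
  have "?q ^ (CARD('n) + 2) = ?q powr (real CARD('n) + 2)"
    using q powr_realpow[of ?q "CARD('n) + 2"] by (simp add: add.commute)
  then have "(?q ^ (CARD('n) + 2)) powr (1 / (real CARD('n) + 2)) = ?q"
    using q by (simp add: powr_powr)
  then show "\<bar>gauss_curvature F u\<bar> powr (1 / (real CARD('n) + 2)) =
    \<bar>det ?B\<bar> powr (1 / (real CARD('n) + 2)) * ?q"
    unfolding K using q by (subst powr_mult) (auto simp del: power_Suc power_add)
qed

end

section \<open>Charts\<close>

context nondegenerate_patch
begin

lemma rel_metric_inv_sym:
  assumes "u \<in> S"
  shows "transpose (rel_metric_inv F Y u) = rel_metric_inv F Y u"
proof -
  let ?R = "rel_metric_inv F Y u"
  note inv = matrix_inv_mult[OF det_G[OF assms], folded rel_metric_inv_def]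
  have "transpose (G u) = G u" by (simp add: vec_eq_iff transpose_def G_sym[OF assms])
  then have "transpose ?R ** G u = mat 1"
    using inv(1) by (metis matrix_transpose_mul transpose_mat)
  then show ?thesis using inv(1) by (metis matrix_mul_assoc matrix_mul_lid matrix_mul_rid)
qed

lemma darboux_zero_of_pick:
  assumes u: "u \<in> S" and dim: "CARD('n) \<ge> 2"
    and definite: "(\<forall>v. v \<noteq> 0 \<longrightarrow> v \<bullet> (G u *v v) > 0) \<or> (\<forall>v. v \<noteq> 0 \<longrightarrow> v \<bullet> (G u *v v) < 0)"
    and pick: "pick_invariant F Y u = 0"
  shows "darboux F Y j k l u = 0"
proof -
  let ?R = "rel_metric_inv F Y u" and ?T = "\<lambda>j k l. darboux F Y j k l u"
  \<comment> \<open>The sign of the definite form. The inverse metric enters three times, so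
    replacing \<open>?R\<close> by \<open>s *\<^sub>R ?R\<close> multiplies the vanishing sum by
    \<open>s * s * s = s\<close>.\<close>
  define s :: real where "s = (if \<forall>v. v \<noteq> 0 \<longrightarrow> v \<bullet> (G u *v v) > 0 then 1 else - 1)"
  have s: "s * s = 1" by (simp add: s_def)
  have sG: "s * (v \<bullet> (G u *v v)) > 0" if "v \<noteq> 0" for v
    using definite that by (auto simp: s_def)
  have GR: "G u *v (?R *v v) = v" for v
    using matrix_inv_mult(1)[OF det_G[OF u]] by (simp add: matrix_vector_mul_assoc rel_metric_inv_def)
  \<comment> \<open>\<open>dim\<close> keeps the factor in \<open>pick_invariant\<close> from being
    0, which it would be in dimension 1 as \<open>1 / 0 = 0\<close>.\<close>
  have "(\<Sum>j\<in>UNIV. \<Sum>k\<in>UNIV. \<Sum>l\<in>UNIV. ?T j k l * darboux_up F Y j k l u) = 0"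
    using pick dim by (simp add: pick_invariant_def)
  then have zero: "(\<Sum>j\<in>UNIV. \<Sum>k\<in>UNIV. \<Sum>l\<in>UNIV. ?T j k l * (\<Sum>a\<in>UNIV. \<Sum>b\<in>UNIV. \<Sum>c\<in>UNIV.
      ?R $ j $ a * ?R $ k $ b * ?R $ l $ c * ?T a b c)) = 0"
    by (simp only: darboux_up_def)
  show ?thesis
  proof (rule positive_definite_tensor_cube[of "s *\<^sub>R ?R"])
    show "(s *\<^sub>R ?R) $ i $ j = (s *\<^sub>R ?R) $ j $ i" for i j
      using rel_metric_inv_sym[OF u] by (simp add: vec_eq_iff transpose_def)
    show "v \<bullet> ((s *\<^sub>R ?R) *v v) > 0" if "v \<noteq> 0" for v
    proof -
      \<comment> \<open>With \<open>w = ?R *v v\<close> the form of \<open>?R\<close> at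
        \<open>v\<close> is the form of \<open>G\<close> at \<open>w\<close>.\<close>
      have "?R *v v \<noteq> 0" using GR[of v] that by auto
      from sG[OF this] show ?thesis
        by (simp add: GR inner_commute flip: scaleR_matrix_vector_assoc)
    qed
    have "(s *\<^sub>R ?R) $ j $ a * (s *\<^sub>R ?R) $ k $ b * (s *\<^sub>R ?R) $ l $ c * ?T a b c
        = s * (?R $ j $ a * ?R $ k $ b * ?R $ l $ c * ?T a b c)" for j k l a b c
    proof -
      have "(s *\<^sub>R ?R) $ j $ a * (s *\<^sub>R ?R) $ k $ b * (s *\<^sub>R ?R) $ l $ c * ?T a b c
        = (s * s) * (s * (?R $ j $ a * ?R $ k $ b * ?R $ l $ c * ?T a b c))"
        by (simp add: mult_ac)
      then show ?thesis by (simp only: s mult_1)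
    qed
    then show "(\<Sum>j\<in>UNIV. \<Sum>k\<in>UNIV. \<Sum>l\<in>UNIV. ?T j k l * (\<Sum>a\<in>UNIV. \<Sum>b\<in>UNIV. \<Sum>c\<in>UNIV.
      (s *\<^sub>R ?R) $ j $ a * (s *\<^sub>R ?R) $ k $ b * (s *\<^sub>R ?R) $ l $ c * ?T a b c)) = 0"
      using zero by (simp only: sum_distrib_left[symmetric] mult.left_commute[of _ s] mult_zero_right)
  qed
qed

end

section \<open>Passage between the manifold and its charts\<close>

lemma in_coords_apply:
  assumes "is_chart M c" "p \<in> fst c"
  shows "in_coords c f (snd c p) = f p" "snd c p \<in> coord_dom c"
proof -
  have "fst c \<subseteq> topspace M" using assms(1) by (simp add: is_chart_def openin_subset)
  moreover have "inj_on (snd c) (topspace (subtopology M (fst c)))"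
    using assms(1) unfolding is_chart_def by (blast intro: homeomorphic_imp_injective_map)
  ultimately have "inj_on (snd c) (fst c)" by (simp add: Int_absorb1)
  then show "in_coords c f (snd c p) = f p" using assms(2) by (simp add: in_coords_def)
  show "snd c p \<in> coord_dom c" using assms(2) by (simp add: coord_dom_def)
qed

lemma chart_preimage_open:
  assumes "is_chart M c" "open V"
  shows "openin M {p \<in> fst c. snd c p \<in> V}"
proof -
  have M: "openin M (fst c)" "fst c \<subseteq> topspace M"
    using assms(1) by (auto simp: is_chart_def openin_subset)
  have "continuous_map (subtopology M (fst c)) (top_of_set (coord_dom c)) (snd c)"
    using assms(1) homeomorphic_imp_continuous_map by (auto simp: is_chart_def)
  then have "continuous_map (subtopology M (fst c)) euclidean (snd c)"
    by (simp add: continuous_map_in_subtopology)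
  then have "openin (subtopology M (fst c)) {p \<in> topspace (subtopology M (fst c)). snd c p \<in> V}"
    by (rule openin_continuous_map_preimage) (use assms(2) in simp)
  then show ?thesis
    using M by (simp add: openin_open_subtopology Int_absorb1)
qed

lemma chart_image_open:
  assumes "is_chart M c" "openin M U"
  shows "open (snd c ` (U \<inter> fst c))"
proof -
  have M: "openin M (fst c)" "open (coord_dom c)"
    using assms(1) by (auto simp: is_chart_def)
  have "open_map (subtopology M (fst c)) (top_of_set (coord_dom c)) (snd c)"
    using assms(1) homeomorphic_imp_open_map by (auto simp: is_chart_def)
  moreover have "openin (subtopology M (fst c)) (U \<inter> fst c)"
    using assms(2) M(1) by (simp add: openin_open_subtopology openin_Int)
  ultimately have "openin (top_of_set (coord_dom c)) (snd c ` (U \<inter> fst c))"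
    by (simp add: open_map_def)
  then show ?thesis using M(2) by (simp add: openin_open_eq)
qed

context relative_patch
begin

lemma second_form_det_pos_definite:
  assumes "u \<in> S" "CARD('n) = 2" "gauss_curvature F u > 0"
  shows "(\<forall>v. v \<noteq> 0 \<longrightarrow> v \<bullet> (second_form F u *v v) > 0) \<or> (\<forall>v. v \<noteq> 0 \<longrightarrow> v \<bullet> (second_form F u *v v) < 0)"
proof (rule definite_of_det_pos[OF assms(2)])
  have "det (first_form F u) \<ge> 0" by (simp add: det_first_form[OF assms(1)])
  then show "det (second_form F u) > 0"
    using assms(3) by (auto simp: gauss_curvature_def zero_less_divide_iff)
  show "second_form F u $ i $ j = second_form F u $ j $ i" for i j
    by (simp add: second_form_eq[OF assms(1)] G_sym[OF assms(1), of i j])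
qed

lemma G_definite:
  assumes "u \<in> S"
    and "(\<forall>v. v \<noteq> 0 \<longrightarrow> v \<bullet> (second_form F u *v v) > 0) \<or> (\<forall>v. v \<noteq> 0 \<longrightarrow> v \<bullet> (second_form F u *v v) < 0)"
  shows "(\<forall>v. v \<noteq> 0 \<longrightarrow> v \<bullet> (G u *v v) > 0) \<or> (\<forall>v. v \<noteq> 0 \<longrightarrow> v \<bullet> (G u *v v) < 0)"
proof -
  have "v \<bullet> (second_form F u *v v) = support_function F Y u * (v \<bullet> (G u *v v))" for v
    by (simp add: second_form_eq[OF assms(1)] flip: scaleR_matrix_vector_assoc)
  then show ?thesis
    using assms(2) support_pos[OF assms(1)] by (simp add: zero_less_mult_iff mult_less_0_iff)
qed

end

lemma chart_patch:
  fixes M :: "'a topology" and \<A> :: "('a, 'n::finite) chart set"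
    and x y :: "'a \<Rightarrow> real^('n option)" and r s :: nat
  assumes "CARD('n) \<ge> 2" and "r \<ge> 3" and "1 \<le> s" and "s < r"
    and "hypersurface r M \<A> x"
    and "positive_gauss_curvature \<A> x"
    and "CARD('n) > 2 \<longrightarrow> definite_second_form \<A> x"
    and "relative_normalization s \<A> x y"
    and "positive_support \<A> x y"
    and "vanishing_pick_invariant \<A> x y"
    and c: "c \<in> \<A>"
  shows "flat_patch (in_coords c x) (in_coords c y) (coord_dom c)"
proof -
  let ?F = "in_coords c x" and ?Y = "in_coords c y" and ?S = "coord_dom c"
  have K: "gauss_curvature ?F u > 0" if "u \<in> ?S" for u
    using assms(6) c that by (simp add: positive_gauss_curvature_def)
  interpret relative_patch ?F ?Y ?S
  proof
    show "open ?S"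
      using assms(5) c by (auto simp: hypersurface_def oriented_connected_manifold_def oriented_Cr_atlas_def is_chart_def)
    have "Ck_on r ?F ?S" using assms(5) c by (auto simp: hypersurface_def Cr_map_def)
    then show "Ck_on 3 ?F ?S" using assms(2) by (rule Ck_on_mono)
    have "Ck_on s ?Y ?S" using assms(8) c by (auto simp: relative_normalization_def Cr_map_def)
    then show "Ck_on 1 ?Y ?S" using assms(3) by (rule Ck_on_mono)
    show "(\<forall>i. a i = 0) \<and> b = 0"
      if "u \<in> ?S" "(\<Sum>i\<in>UNIV. a i *\<^sub>R pd i ?F u) + b *\<^sub>R ?Y u = 0" for u a b
      using assms(8) c that unfolding relative_normalization_def Let_def by blast
    show "pd i ?Y u \<in> span (range (\<lambda>j. pd j ?F u))" if "u \<in> ?S" for u i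
      using assms(8) c that unfolding relative_normalization_def Let_def by blast
    show "support_function ?F ?Y u > 0" if "u \<in> ?S" for u
      using assms(9) c that by (simp add: positive_support_def)
  qed
  interpret nondegenerate_patch ?F ?Y ?S
  proof
    show "det (rel_metric ?F ?Y u) \<noteq> 0" if "u \<in> ?S" for u
      using gauss_curvature_eq[OF that] K[OF that] det_E[OF that] by auto
  qed
  show ?thesis
  proof
    fix u j k l assume u: "u \<in> ?S"
    have "(\<forall>v. v \<noteq> 0 \<longrightarrow> v \<bullet> (second_form ?F u *v v) > 0) \<or> (\<forall>v. v \<noteq> 0 \<longrightarrow> v \<bullet> (second_form ?F u *v v) < 0)"
    \<comment> \<open>For surfaces definiteness follows from \<open>K > 0\<close>; in higher
      dimension it is assumed.\<close>
    proof (cases "CARD('n) = 2")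
      case True
      then show ?thesis by (rule second_form_det_pos_definite[OF u _ K[OF u]])
    next
      case False
      then have "definite_second_form \<A> x" using assms(1,7) by simp
      then show ?thesis using c u unfolding definite_second_form_def Let_def by blast
    qed
    moreover have "pick_invariant ?F ?Y u = 0"
      using assms(10) c u by (simp add: vanishing_pick_invariant_def)
    ultimately show "darboux ?F ?Y j k l u = 0"
      by (intro darboux_zero_of_pick[OF u assms(1)] G_definite[OF u])
  qed (rule assms(1))
qed

text \<open>The equiaffine normalization will be exhibited as a constant multiple of
  \<open>y\<close>.\<close>

lemma relative_normalization_scaleR:
  assumes "relative_normalization s \<A> x y" "\<kappa> \<noteq> 0" "1 \<le> s" "\<forall>c\<in>\<A>. open (coord_dom c)"
  shows "relative_normalization s \<A> x (\<lambda>p. \<kappa> *\<^sub>R y p)"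
proof -
  have in_coords: "in_coords c (\<lambda>p. \<kappa> *\<^sub>R y p) = (\<lambda>u. \<kappa> *\<^sub>R in_coords c y u)" for c :: "('a, 'b) chart"
    by (simp add: in_coords_def comp_def)
  have Y: "Ck_on s (in_coords c y) (coord_dom c)" if "c \<in> \<A>" for c
    using assms(1) that by (simp add: relative_normalization_def Cr_map_def)
  have diff: "in_coords c y differentiable (at u)" if "c \<in> \<A>" "u \<in> coord_dom c" for c u
    using Ck_on_mono[OF Y[OF that(1)] assms(3)] that(2) by simp
  show ?thesis
    unfolding relative_normalization_def Let_def
  proof (intro conjI ballI allI impI)
    show "Cr_map s \<A> (\<lambda>p. \<kappa> *\<^sub>R y p)"
      unfolding Cr_map_def in_coords using Y assms(4) by (auto intro: Ck_on_scaleR)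
  next
    fix c u i assume cu: "c \<in> \<A>" "u \<in> coord_dom c"
    have "pd i (in_coords c y) u \<in> span (range (\<lambda>j. pd j (in_coords c x) u))"
      using assms(1) cu unfolding relative_normalization_def Let_def by blast
    then show "pd i (in_coords c (\<lambda>p. \<kappa> *\<^sub>R y p)) u \<in> span (range (\<lambda>j. pd j (in_coords c x) u))"
      unfolding in_coords pd_bounded_linear(1)[OF bounded_linear_scaleR_right diff[OF cu]]
      by (rule span_scale)
  next
    fix c u a b i assume cu: "c \<in> \<A>" "u \<in> coord_dom c"
      and sum: "(\<Sum>i\<in>UNIV. a i *\<^sub>R pd i (in_coords c x) u) + b *\<^sub>R in_coords c (\<lambda>p. \<kappa> *\<^sub>R y p) u = 0"
    have "(\<Sum>i\<in>UNIV. a i *\<^sub>R pd i (in_coords c x) u) + (b * \<kappa>) *\<^sub>R in_coords c y u = 0"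
      using sum by (simp add: in_coords)
    then have "(\<forall>i. a i = 0) \<and> b * \<kappa> = 0"
      using assms(1) cu unfolding relative_normalization_def Let_def by blast
    then show "a i = 0" "b = 0" using assms(2) by auto
  qed
qed

theorem proposition4p2:
  fixes M :: "'a topology" and \<A> :: "('a, 'n::finite) chart set"
    and x y :: "'a \<Rightarrow> real^('n option)" and r s :: nat
  assumes "CARD('n) \<ge> 2" and "r \<ge> 3" and "1 \<le> s" and "s < r"
    and "hypersurface r M \<A> x"
    and "positive_gauss_curvature \<A> x"
    and "CARD('n) > 2 \<longrightarrow> definite_second_form \<A> x"
    and "relative_normalization s \<A> x y"
    and "positive_support \<A> x y"
    and "vanishing_pick_invariant \<A> x y"
  shows "(\<exists>Q. hyperquadric Q \<and> x ` topspace M \<subseteq> Q) \<and>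
    (\<exists>y_aff. equiaffine_normalization s \<A> x y_aff \<and> constantly_proportional \<A> x y y_aff)"
proof -
  have flat: "flat_patch (in_coords c x) (in_coords c y) (coord_dom c)" if "c \<in> \<A>" for c
    by (rule chart_patch[OF assms that])
  have cover: "(\<Union>c\<in>\<A>. fst c) = topspace M" and conn: "connected_space M"
    and atlas: "\<forall>c\<in>\<A>. is_chart M c"
    using assms(5)
    unfolding hypersurface_def oriented_connected_manifold_def oriented_Cr_atlas_def by blast+
  then have chart: "is_chart M c" if "c \<in> \<A>" for c using that by blast
  have coord_dom_open: "\<forall>c\<in>\<A>. open (coord_dom c)"
    using chart by (auto simp: is_chart_def)
  define on_quadric where "on_quadric = (\<lambda>(A, b, k) p.
    x p \<bullet> (A *v x p) + 2 * (b \<bullet> x p) + k = 0 \<and> (A *v x p + b) \<bullet> y p = - 1)"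
  define symm where "symm = (\<lambda>(A :: real^('n option)^('n option), b :: real^('n option), k :: real). transpose A = A)"
  \<comment> \<open>Demanding the equations on a whole neighbourhood makes \<open>W t\<close> open,
    and it makes \<open>quadric_unique\<close>, which differentiates them, applicable where two such
    sets meet.\<close>
  define W where "W t = {p. \<exists>U. openin M U \<and> p \<in> U \<and> (\<forall>q\<in>U. on_quadric t q)}" for t
  have W_open: "openin M (W t)" for t
    by (subst openin_subopen) (unfold W_def, blast)
  have W_cover: "\<exists>t. symm t \<and> p \<in> W t" if p: "p \<in> topspace M" for p
  proof -
    obtain c where c: "c \<in> \<A>" "p \<in> fst c" using p cover by blast
    interpret flat_patch "in_coords c x" "in_coords c y" "coord_dom c" by (rule flat[OF c(1)])
    note at = in_coords_apply[OF chart[OF c(1)]]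
    obtain U A b k where U: "open U" "snd c p \<in> U" "transpose A = A"
      and Q: "\<And>v. v \<in> U \<Longrightarrow> in_coords c x v \<bullet> (A *v in_coords c x v) + 2 * (b \<bullet> in_coords c x v) + k = 0"
      and N: "\<And>v. v \<in> U \<Longrightarrow> (A *v in_coords c x v + b) \<bullet> in_coords c y v = - 1"
      using local_quadric[OF at(2)[OF c(2)]] by metis
    have "on_quadric (A, b, k) q" if "q \<in> {q \<in> fst c. snd c q \<in> U}" for q
      using Q[of "snd c q"] N[of "snd c q"] that at(1)[where p = q and f = x] at(1)[where p = q and f = y]
      by (simp add: on_quadric_def)
    then have "p \<in> W (A, b, k)"
      unfolding W_def using chart_preimage_open[OF chart[OF c(1)] U(1)] c(2) U(2) by blast
    then show ?thesis using U(3) by (intro exI[of _ "(A, b, k)"]) (simp add: symm_def)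
  qed
  have W_coords: "\<exists>U. open U \<and> snd c p \<in> U \<and> U \<subseteq> coord_dom c \<and>
      (\<forall>v\<in>U. \<exists>q. v = snd c q \<and> in_coords c x v = x q \<and> in_coords c y v = y q \<and> q \<in> V)"
    if "openin M V" "c \<in> \<A>" "p \<in> V" "p \<in> fst c" for V c p
  proof (rule exI[of _ "snd c ` (V \<inter> fst c)"], intro conjI ballI)
    note at = in_coords_apply[OF chart[OF that(2)]]
    show "open (snd c ` (V \<inter> fst c))" by (rule chart_image_open[OF chart[OF that(2)] that(1)])
    show "snd c p \<in> snd c ` (V \<inter> fst c)" using that by blast
    show "snd c ` (V \<inter> fst c) \<subseteq> coord_dom c" using at(2) by blast
    show "\<exists>q. v = snd c q \<and> in_coords c x v = x q \<and> in_coords c y v = y q \<and> q \<in> V"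
      if "v \<in> snd c ` (V \<inter> fst c)" for v
      using that at(1)[where f = x] at(1)[where f = y] by auto
  qed
  have W_quadric: "on_quadric t q" if "q \<in> W t" for t q
    using that by (auto simp: W_def)
  have W_disjoint: "t = t'" if t: "symm t" "symm t'" and p: "p \<in> W t" "p \<in> W t'" for t t' p
  proof -
    obtain A b k A' b' k' where tt: "t = (A, b, k)" "t' = (A', b', k')" by (metis prod_cases3)
    have "p \<in> topspace M" using p(1) openin_subset[OF W_open[of t]] by blast
    then obtain c where c: "c \<in> \<A>" "p \<in> fst c" using cover by blast
    interpret flat_patch "in_coords c x" "in_coords c y" "coord_dom c" by (rule flat[OF c(1)])
    obtain U where U: "open U" "snd c p \<in> U" "U \<subseteq> coord_dom c"
      and UV: "\<And>v. v \<in> U \<Longrightarrow> \<exists>q. v = snd c q \<and> in_coords c x v = x q \<and> in_coords c y v = y q \<and> q \<in> W t \<inter> W t'"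
      using W_coords[OF openin_Int[OF W_open[of t] W_open[of t']] c(1) IntI[OF p] c(2)] by blast
    have Q: "in_coords c x v \<bullet> (A *v in_coords c x v) + 2 * (b \<bullet> in_coords c x v) + k = 0"
      "in_coords c x v \<bullet> (A' *v in_coords c x v) + 2 * (b' \<bullet> in_coords c x v) + k' = 0"
      "(A *v in_coords c x v + b) \<bullet> in_coords c y v = - 1"
      "(A' *v in_coords c x v + b') \<bullet> in_coords c y v = - 1" if "v \<in> U" for v
    proof -
      obtain q where q: "in_coords c x v = x q" "in_coords c y v = y q" "q \<in> W t" "q \<in> W t'"
        using UV[OF \<open>v \<in> U\<close>] by blast
      have "on_quadric (A, b, k) q" "on_quadric (A', b', k') q"
        using W_quadric[OF q(3)] W_quadric[OF q(4)] by (simp_all only: tt)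
      then show "in_coords c x v \<bullet> (A *v in_coords c x v) + 2 * (b \<bullet> in_coords c x v) + k = 0"
      "in_coords c x v \<bullet> (A' *v in_coords c x v) + 2 * (b' \<bullet> in_coords c x v) + k' = 0"
      "(A *v in_coords c x v + b) \<bullet> in_coords c y v = - 1"
      "(A' *v in_coords c x v + b') \<bullet> in_coords c y v = - 1"
        unfolding q(1,2) on_quadric_def by auto
    qed
    have "transpose A = A" "transpose A' = A'" using t by (simp_all add: symm_def tt)
    from quadric_unique[OF U this Q] show ?thesis by (simp add: tt)
  qed
  show ?thesis
  proof (cases "topspace M = {}")
    \<comment> \<open>The empty space counts as connected. Without a point no quadric can be read
      off, so an arbitrary one is given, and \<open>y\<close> itself is vacuously
      equiaffine.\<close>
    case True
    have "(mat 1 :: real^('n option)^('n option)) \<noteq> 0"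
      by (simp add: vec_eq_iff mat_def)
    then have "hyperquadric {v :: real^('n option). v \<bullet> (mat 1 *v v) + 0 \<bullet> v + 0 = 0}"
      unfolding hyperquadric_def by (metis transpose_mat)
    moreover have "coord_dom c = {}" if "c \<in> \<A>" for c
      using True cover that by (auto simp: coord_dom_def)
    then have "equiaffine_normalization s \<A> x y \<and> constantly_proportional \<A> x y y"
      using assms(8) by (auto simp: equiaffine_normalization_def constantly_proportional_def intro!: exI[of _ 1])
    ultimately show ?thesis using True by auto
  next
    case False
    then obtain p0 t where p0: "p0 \<in> topspace M" and t: "symm t" "p0 \<in> W t"
      using W_cover by blast
    have "W t = topspace M"
    proof (rule ccontr)
      assume "W t \<noteq> topspace M"
      \<comment> \<open>By \<open>W_cover\<close> and \<open>W_disjoint\<close> the other sets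
        \<open>W t'\<close> form an open complement of \<open>W t\<close>.\<close>
      define V where "V = (\<Union>t'\<in>{t'. symm t' \<and> t' \<noteq> t}. W t')"
      have "openin M V" unfolding V_def using W_open by auto
      moreover have "W t \<subseteq> topspace M" using openin_subset[OF W_open] by blast
      moreover have "topspace M \<subseteq> W t \<union> V" using W_cover unfolding V_def by blast
      moreover have "W t \<inter> V = {}" using W_disjoint[OF t(1)] unfolding V_def by blast
      moreover have "V \<noteq> {}" using \<open>W t \<noteq> topspace M\<close> calculation(2,3) by blast
      ultimately show False
        using conn W_open[of t] t(2) unfolding connected_space_def by blast
    qed
    obtain A b k where tt: "t = (A, b, k)" by (metis prod_cases3)
    have A: "transpose A = A" using t(1) by (simp add: tt symm_def)
    have on: "x p \<bullet> (A *v x p) + 2 * (b \<bullet> x p) + k = 0" "(A *v x p + b) \<bullet> y p = - 1" if "p \<in> topspace M" for p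
      using W_quadric[of p t] that \<open>W t = topspace M\<close> by (simp_all add: tt on_quadric_def)
    have coords: "in_coords c x v \<bullet> (A *v in_coords c x v) + 2 * (b \<bullet> in_coords c x v) + k = 0"
      "(A *v in_coords c x v + b) \<bullet> in_coords c y v = - 1" if c: "c \<in> \<A>" and v: "v \<in> coord_dom c" for c v
    proof -
      obtain p where p: "p \<in> fst c" "v = snd c p" using v by (auto simp: coord_dom_def)
      then have "p \<in> topspace M" using c cover by blast
      then show "in_coords c x v \<bullet> (A *v in_coords c x v) + 2 * (b \<bullet> in_coords c x v) + k = 0"
        "(A *v in_coords c x v + b) \<bullet> in_coords c y v = - 1"
        using on in_coords_apply(1)[OF chart[OF c] p(1), of x] in_coords_apply(1)[OF chart[OF c] p(1), of y]
        by (simp_all add: p(2))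
    qed
    let ?B = "bordered A b k"
    \<comment> \<open>The factor for which \<open>\<kappa> y\<close> has the equiaffine support
      function \<open>|K|^(1 / (n + 2))\<close>.\<close>
    define \<kappa> where "\<kappa> = \<bar>det ?B\<bar> powr (1 / (real CARD('n) + 2))"
    have K: "\<bar>gauss_curvature (in_coords c x) u\<bar> powr (1 / (real CARD('n) + 2)) =
        \<kappa> * support_function (in_coords c x) (in_coords c y) u" "det ?B \<noteq> 0" "A \<noteq> 0"
      if c: "c \<in> \<A>" and u: "u \<in> coord_dom c" for c u
    proof -
      interpret flat_patch "in_coords c x" "in_coords c y" "coord_dom c" by (rule flat[OF c])
      show "\<bar>gauss_curvature (in_coords c x) u\<bar> powr (1 / (real CARD('n) + 2)) =
        \<kappa> * support_function (in_coords c x) (in_coords c y) u" "det ?B \<noteq> 0" "A \<noteq> 0"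
        using support_eq_gauss_curvature[OF open_S u order.refl A coords[OF c]]
          quadric_det(2)[OF open_S u order.refl A coords[OF c]]
        by (auto simp: \<kappa>_def)
    qed
    obtain c0 where c0: "c0 \<in> \<A>" "p0 \<in> fst c0" using p0 cover by blast
    note u0 = in_coords_apply(2)[OF chart[OF c0(1)] c0(2)]
    have "\<kappa> > 0" using K(2)[OF c0(1) u0] by (simp add: \<kappa>_def)
    have supp: "support_function (in_coords c x) (in_coords c (\<lambda>p. \<kappa> *\<^sub>R y p)) u =
        \<kappa> * support_function (in_coords c x) (in_coords c y) u" for c u
      by (simp add: support_function_def in_coords_def)
    \<comment> \<open>The linear term in \<open>hyperquadric\<close> carries no factor 2, hence
      \<open>2 *\<^sub>R b\<close>.\<close>
    have "hyperquadric {v. v \<bullet> (A *v v) + (2 *\<^sub>R b) \<bullet> v + k = 0}"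
      unfolding hyperquadric_def using A K(3)[OF c0(1) u0] by blast
    moreover have "x ` topspace M \<subseteq> {v. v \<bullet> (A *v v) + (2 *\<^sub>R b) \<bullet> v + k = 0}"
      using on(1) by auto
    moreover have "equiaffine_normalization s \<A> x (\<lambda>p. \<kappa> *\<^sub>R y p)"
      unfolding equiaffine_normalization_def
      using relative_normalization_scaleR[OF assms(8) _ assms(3) coord_dom_open, of \<kappa>] \<open>\<kappa> > 0\<close> K(1)
      by (simp add: supp)
    \<comment> \<open>The equiaffine field is \<open>\<kappa> y\<close>, so the constant for
      \<open>y\<close> is the reciprocal of \<open>\<kappa>\<close>.\<close>
    moreover have "constantly_proportional \<A> x y (\<lambda>p. \<kappa> *\<^sub>R y p)"
      unfolding constantly_proportional_def
      using \<open>\<kappa> > 0\<close> by (intro exI[of _ "1 / \<kappa>"]) (simp add: supp)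
    ultimately show ?thesis by blast
  qed
qed

end
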